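(* Let $d\in\mathbb{N}$, $d\ge3$, and let $P$ be a random polytope uniformly distributed in $\mathcal{P}(\{0,1\}^d)$. Then one has $$\operatorname{Prob}\left(\operatorname{sxc}(P)\le\frac{2^{d/4}}{3\sqrt d}\right)\le2^{-2^{d-1}}\qquad\text{and}\qquad\operatorname{Prob}\left(\operatorname{xc}(P)\le\frac{2^{d/2}}{9d}\right)\le2^{-2^{d-1}}.$$
   Context: $\mathbb{N}=\{1,2,3,\ldots\}$. For a finite set $X\subseteq\mathbb{R}^d$, $\mathcal{P}(X)=\{\operatorname{conv}(X'):X'\subseteq X\}$ (including the empty polytope); thus $\mathcal{P}(\{0,1\}^d)$ is the set of all $0/1$-polytopes in $\mathbb{R}^d$. $\mathcal{S}^k$ is the space of real symmetric $k\times k$ matrices and $\mathcal{S}^k_+$ the cone of positive semidefinite matrices in it. A set $P\subseteq\mathbb{R}^d$ has an extended formulation with an LMI of size $k$ if there exist $n\in\mathbb{N}$ and affine maps $\varphi:\mathbb{R}^n\to\mathbb{R}^d$ and $M:\mathbb{R}^n\to\mathcal{S}^k$ such that $P=\varphi(Q)$ with $Q=\{x\in\mathbb{R}^n:M(x)\in\mathcal{S}^k_+\}$. If moreover $M(x)$ is a diagonal matrix for all $x$ and $k=\ell$ (so that $Q$ is defined by $\ell$ linear inequalities), it is an extended formulation with $\ell$ linear inequalities. For a polytope $P$, the semidefinite extension complexity $\operatorname{sxc}(P)$ is the smallest $k$ such that $P$ has an extended formulation with an LMI of size $k$; the linear extension complexity $\operatorname{xc}(P)$ is the smallest $\ell$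 such that $P$ has an extended formulation with $\ell$ linear inequalities. If $P$ is empty or a single point, $\operatorname{sxc}(P)=\operatorname{xc}(P)=0$. *)

theory Defs
  imports "HOL-Probability.Probability" "Jordan_Normal_Form.Matrix"
begin

no_notation Matrix.vec_index (infixl "$" 100)
no_notation Matrix.scalar_prod (infix "\<bullet>" 70)

definition subpolytopes :: "'a::real_vector set \<Rightarrow> 'a set set" where
  "subpolytopes X = {convex hull Y | Y. Y \<subseteq> X}"

definition zero_one_points :: "(real ^ 'd) set" where
  "zero_one_points = {x. \<forall>i. x $ i \<in> {0, 1}}"

definition symmetric_mats :: "nat \<Rightarrow> real mat set" where
  "symmetric_mats k = {A \<in> carrier_mat k k. transpose_mat A = A}"

definition psd_cone :: "nat \<Rightarrow> real mat set" where
  "psd_cone k =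
     {A \<in> symmetric_mats k. \<forall>v \<in> carrier_vec k. 0 \<le> scalar_prod v (A *\<^sub>v v)}"

text \<open>
  The dimension of the source space of an extended formulation is existentially quantified,
  so that space is represented by \<^term>\<open>carrier_vec n :: real vec set\<close>; the values of a map
  outside this carrier are irrelevant. A map is affine if it preserves affine combinations.
\<close>

definition affine_point_map :: "nat \<Rightarrow> (real vec \<Rightarrow> real ^ 'd) \<Rightarrow> bool" where
  "affine_point_map n \<phi> \<longleftrightarrow>
     (\<forall>x \<in> carrier_vec n. \<forall>y \<in> carrier_vec n. \<forall>t.
        \<phi> ((1 - t) \<cdot>\<^sub>v x + t \<cdot>\<^sub>v y) = (1 - t) *\<^sub>R \<phi> x + t *\<^sub>R \<phi> y)"

definition affine_matrix_map :: "nat \<Rightarrow> nat \<Rightarrow> (real vec \<Rightarrow> real mat) \<Rightarrow> bool" where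
  "affine_matrix_map n k M \<longleftrightarrow>
     (\<forall>x \<in> carrier_vec n. M x \<in> symmetric_mats k) \<and>
     (\<forall>x \<in> carrier_vec n. \<forall>y \<in> carrier_vec n. \<forall>t.
        M ((1 - t) \<cdot>\<^sub>v x + t \<cdot>\<^sub>v y) = (1 - t) \<cdot>\<^sub>m M x + t \<cdot>\<^sub>m M y)"

definition extended_formulation ::
  "nat \<Rightarrow> nat \<Rightarrow> (real vec \<Rightarrow> real ^ 'd) \<Rightarrow> (real vec \<Rightarrow> real mat) \<Rightarrow> (real ^ 'd) set \<Rightarrow> bool" where
  "extended_formulation n k \<phi> M P \<longleftrightarrow>
     1 \<le> n \<and> affine_point_map n \<phi> \<and> affine_matrix_map n k M \<and>
     P = \<phi> ` {x \<in> carrier_vec n. M x \<in> psd_cone k}"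

definition has_LMI_extension :: "nat \<Rightarrow> (real ^ 'd) set \<Rightarrow> bool" where
  "has_LMI_extension k P \<longleftrightarrow> (\<exists>n \<phi> M. extended_formulation n k \<phi> M P)"

definition has_linear_extension :: "nat \<Rightarrow> (real ^ 'd) set \<Rightarrow> bool" where
  "has_linear_extension l P \<longleftrightarrow>
     (\<exists>n \<phi> M. extended_formulation n l \<phi> M P \<and> (\<forall>x \<in> carrier_vec n. diagonal_mat (M x)))"

text \<open>
  Every polytope has an extended formulation with finitely many linear inequalities, so on
  polytopes the minima below are attained. On other sets the values carry no meaning.
\<close>

definition sxc :: "(real ^ 'd) set \<Rightarrow> nat" where
  "sxc P = (if P = {} \<or> (\<exists>p. P = {p}) then 0 else (LEAST k. has_LMI_extension k P))"

definition xc :: "(real ^ 'd) set \<Rightarrow> nat" where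
  "xc P = (if P = {} \<or> (\<exists>p. P = {p}) then 0 else (LEAST l. has_linear_extension l P))"

text \<open>
  The uniform distribution \<^const>\<open>pmf_of_set\<close> is meaningful only on finite nonempty sets.
\<close>

lemma finite_zero_one_points: "finite (zero_one_points :: (real ^ 'd) set)"
proof (rule finite_subset)
  show "(zero_one_points :: (real ^ 'd) set) \<subseteq> vec_lambda ` (UNIV \<rightarrow>\<^sub>E {0, 1})"
  proof
    fix x :: "real ^ 'd"
    assume "x \<in> zero_one_points"
    then have "vec_nth x \<in> UNIV \<rightarrow>\<^sub>E {0, 1}"
      by (auto simp: zero_one_points_def)
    then show "x \<in> vec_lambda ` (UNIV \<rightarrow>\<^sub>E {0, 1})"
      by (metis image_eqI vec_nth_inverse)
  qed
  show "finite (vec_lambda ` (UNIV \<rightarrow>\<^sub>E {0, 1}) :: (real ^ 'd) set)"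
    by (intro finite_imageI finite_PiE) auto
qed

lemma subpolytopes_conv_image: "subpolytopes X = (\<lambda>Y. convex hull Y) ` Pow X"
  by (auto simp: subpolytopes_def)

lemma finite_subpolytopes: "finite X \<Longrightarrow> finite (subpolytopes X)"
  by (simp add: subpolytopes_conv_image)

lemma subpolytopes_nonempty: "subpolytopes X \<noteq> {}"
  by (auto simp: subpolytopes_conv_image)

end

theory Submission
  imports Defs
begin

text \<open>
  A 0/1-polytope is determined by its vertex set \<open>F\<close>, so there are \<open>2 ^ 2 ^ d\<close> of them, and it suffices
  to show that at most \<open>2 ^ 2 ^ (d - 1)\<close> have small extension complexity. Given an extended
  formulation, choose a lift of every vertex and normalize the matrix space so that the sum of the
  lifted matrices is a (possibly degenerate) identity. The lift is then a table with one row for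
  each matrix coordinate and one column for each vertex. An orthonormal basis of its row space, in
  which boundedness of the polytope also puts the vertex coordinates, encodes the extension by
  a matrix of size about \<open>m \<times> (m + d)\<close>, where \<open>m\<close> is the number of matrix coordinates.

  If two polytopes have codes that agree up to \<open>4 ^ (- d)\<close>, then a vertex of the first yields an
  approximate lift for the second. A small multiple of the sum of all lifts repairs it, which gives
  a point of the second polytope at distance less than 1 in the sum norm; so the vertex
  belongs to the second polytope, too. Hence rounded codes determine the polytope, and
  counting them gives the bound.
\<close>

section \<open>Orthogonalization for semidefinite forms\<close>

text \<open>\<open>B\<close> may be degenerate, because the sum of the lifted matrices can be
  singular. One equation encodes linearity in the first argument; symmetry transfers it to the
  second.\<close>

locale psd_form =
  fixes B :: "('i \<Rightarrow> real) \<Rightarrow> ('i \<Rightarrow> real) \<Rightarrow> real"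
  assumes add_scale: "B (\<lambda>i. x i + c * y i) z = B x z + c * B y z"
    and commute: "B x y = B y x"
    and nonneg: "0 \<le> B x x"
begin

lemma zero: "B (\<lambda>i. 0) z = 0"
  using add_scale[of "\<lambda>i. 0" "-1" "\<lambda>i. 0" z] by simp

lemma scale: "B (\<lambda>i. c * y i) z = c * B y z"
  using add_scale[of "\<lambda>i. 0" c y z] zero by simp

lemma diff_scale: "B (\<lambda>i. x i - c * y i) z = B x z - c * B y z"
  using add_scale[of x "- c" y z] by simp

lemma sum_scale:
  assumes "finite J"
  shows "B (\<lambda>i. \<Sum>a\<in>J. c a * u a i) z = (\<Sum>a\<in>J. c a * B (u a) z)"
  using assms
proof induction
  case empty
  then show ?case by (simp add: zero)
next
  case (insert b J)
  have "B (\<lambda>i. \<Sum>a\<in>insert b J. c a * u a i) z = B (\<lambda>i. (\<Sum>a\<in>J. c a * u a i) + c b * u b i) z"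
    using insert by (simp add: add.commute)
  then show ?case using insert by (simp add: add_scale)
qed

lemma add_sum_scale:
  assumes "finite J"
  shows "B (\<lambda>i. x i + (\<Sum>a\<in>J. c a * u a i)) z = B x z + (\<Sum>a\<in>J. c a * B (u a) z)"
  using add_scale[of x 1 "\<lambda>i. \<Sum>a\<in>J. c a * u a i" z] by (simp add: sum_scale assms)

lemma diff_sum_scale:
  assumes "finite J"
  shows "B (\<lambda>i. x i - (\<Sum>a\<in>J. c a * u a i)) z = B x z - (\<Sum>a\<in>J. c a * B (u a) z)"
  using diff_scale[of x 1 "\<lambda>i. \<Sum>a\<in>J. c a * u a i" z] by (simp add: sum_scale assms)

lemma expand_square:
  "B (\<lambda>i. x i + c * y i) (\<lambda>i. x i + c * y i) = B x x + 2 * c * B x y + c\<^sup>2 * B y y"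
  unfolding add_scale commute[of _ "\<lambda>i. x i + c * y i"]
  by (simp add: commute[of y x] power2_eq_square algebra_simps)

text \<open>The degenerate case of Cauchy-Schwarz: along the line \<open>y + t * x\<close> the form
  is affine in \<open>t\<close>, so nonnegativity forces its slope to vanish.\<close>

lemma null_orthogonal:
  assumes "B x x = 0"
  shows "B x y = 0"
proof (rule ccontr)
  assume ne: "B x y \<noteq> 0"
  have "0 \<le> B y y + 2 * t * B y x" for t
    using nonneg[of "\<lambda>i. y i + t * x i"] assms by (simp add: expand_square)
  \<comment> \<open>For this \<open>t\<close> the nonnegative expression would equal -1.\<close>
  from this[of "- (B y y + 1) / (2 * B x y)"] show False
    using ne by (simp add: commute[of y x] field_simps)
qed

lemma add_null:
  assumes "B z z = 0"
  shows "B (\<lambda>i. x i + z i) (\<lambda>i. x i + z i) = B x x"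
  using expand_square[of x 1 z] null_orthogonal[OF assms, of x] assms by (simp add: commute)

lemma sum_null:
  assumes "finite J" "\<And>a. a \<in> J \<Longrightarrow> B (u a) (u a) = 0"
  shows "B (\<lambda>i. \<Sum>a\<in>J. c a * u a i) (\<lambda>i. \<Sum>a\<in>J. c a * u a i) = 0"
  unfolding sum_scale[OF assms(1)] using null_orthogonal assms by simp

text \<open>Expand the nonnegative values of the form at \<open>x + y\<close> and
  \<open>x - y\<close>.\<close>

lemma abs_le_one:
  assumes "B x x \<le> 1" "B y y \<le> 1"
  shows "\<bar>B x y\<bar> \<le> 1"
  using nonneg[of "\<lambda>i. x i + 1 * y i"] nonneg[of "\<lambda>i. x i + (- 1) * y i"] assms
  unfolding expand_square by simp

text \<open>Vectors of length zero are kept in the orthogonal system, so that its index set is the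
  index set \<open>J\<close> of the given vectors and no rank has to be recorded.\<close>

lemma gram_schmidt:
  fixes e :: "'j \<Rightarrow> 'i \<Rightarrow> real"
  assumes "finite J"
  obtains u where "\<And>a b. a \<in> J \<Longrightarrow> b \<in> J \<Longrightarrow> a \<noteq> b \<Longrightarrow> B (u a) (u b) = 0"
    and "\<And>a. a \<in> J \<Longrightarrow> B (u a) (u a) \<in> {0, 1}"
    and "\<And>j. j \<in> J \<Longrightarrow> B (\<lambda>i. e j i - (\<Sum>a\<in>J. B (e j) (u a) * u a i))
                                  (\<lambda>i. e j i - (\<Sum>a\<in>J. B (e j) (u a) * u a i)) = 0"
proof -
  define res where "res J u j = (\<lambda>i. e j i - (\<Sum>a\<in>J. B (e j) (u a) * u a i))"
    for J and u :: "'j \<Rightarrow> 'i \<Rightarrow> real" and j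
  have "\<exists>u. (\<forall>a\<in>J. \<forall>b\<in>J. a \<noteq> b \<longrightarrow> B (u a) (u b) = 0) \<and>
            (\<forall>a\<in>J. B (u a) (u a) \<in> {0, 1}) \<and> (\<forall>j\<in>J. B (res J u j) (res J u j) = 0)"
    using assms
  proof induction
    case empty
    then show ?case by simp
  next
    case (insert j J)
    from insert.IH obtain u where u: "(\<forall>a\<in>J. \<forall>b\<in>J. a \<noteq> b \<longrightarrow> B (u a) (u b) = 0) \<and>
        (\<forall>a\<in>J. B (u a) (u a) \<in> {0, 1}) \<and> (\<forall>j\<in>J. B (res J u j) (res J u j) = 0)"
      by (elim exE)
    have orth: "B (u a) (u b) = 0" if "a \<in> J" "b \<in> J" "a \<noteq> b" for a b using u that by simp
    have unit: "B (u a) (u a) \<in> {0, 1}" if "a \<in> J" for a using u that by simp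
    have null: "B (res J u j) (res J u j) = 0" if "j \<in> J" for j using u that by simp
    define z where "z = res J u j"
    \<comment> \<open>If the residual \<open>z\<close> has length zero, division by zero makes
      \<open>c\<close>, and with it \<open>v j\<close>, zero; the system then contains a vector of
      length 0.\<close>
    define c where "c = 1 / sqrt (B z z)"
    define v where "v = u(j := (\<lambda>i. c * z i))"
    have vJ: "v a = u a" if "a \<in> J" for a using that insert.hyps by (auto simp: v_def)
    have vj: "v j = (\<lambda>i. c * z i)" by (simp add: v_def)
    have res_orth: "B (res J u k) (u b) = 0" if b: "b \<in> J" for b k
    proof -
      have "B (res J u k) (u b) = B (e k) (u b) - (\<Sum>a\<in>J. B (e k) (u a) * B (u a) (u b))"
        by (simp add: res_def diff_sum_scale insert.hyps)
      also have "(\<Sum>a\<in>J. B (e k) (u a) * B (u a) (u b)) = (\<Sum>a\<in>J. if a = b then B (e k) (u b) * B (u b) (u b) else 0)"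
        using orth b by (intro sum.cong) auto
      also have "\<dots> = B (e k) (u b) * B (u b) (u b)" using insert.hyps b by simp
      \<comment> \<open>If \<open>u b\<close> is null, it is orthogonal to \<open>e k\<close> and
        both sides vanish.\<close>
      also have "\<dots> = B (e k) (u b)"
        using unit[OF b] null_orthogonal[of "u b" "e k"] by (auto simp: commute)
      finally show ?thesis by simp
    qed
    have cz: "c\<^sup>2 * B z z = (if B z z = 0 then 0 else 1)"
      using nonneg[of z] by (simp add: c_def power_divide)
    have "B (v j) (v j) = c\<^sup>2 * B z z"
      by (simp add: vj scale commute[of z "\<lambda>i. c * z i"] power2_eq_square)
    then have unit_j: "B (v j) (v j) \<in> {0, 1}" using cz by simp
    have orth_j: "B (v j) (u b) = 0" if "b \<in> J" for b
      using res_orth[OF that] by (simp add: vj scale z_def)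
    have res_insert: "res (insert j J) v k = (\<lambda>i. res J u k i - B (e k) (v j) * v j i)" for k
    proof -
      have "(\<Sum>a\<in>J. B (e k) (v a) * v a i) = (\<Sum>a\<in>J. B (e k) (u a) * u a i)" for i
        by (intro sum.cong) (auto simp: vJ)
      then show ?thesis using insert.hyps by (simp add: res_def fun_eq_iff)
    qed
    have e_decomp: "e k = (\<lambda>i. res J u k i + (\<Sum>a\<in>J. B (e k) (u a) * u a i))" for k
      by (simp add: res_def)
    have e_v: "B (e k) (v j) = B (res J u k) (v j)" for k
    proof -
      have "B (e k) (v j) = B (\<lambda>i. res J u k i + (\<Sum>a\<in>J. B (e k) (u a) * u a i)) (v j)"
        using e_decomp[of k] by simp
      also have "\<dots> = B (res J u k) (v j) + (\<Sum>a\<in>J. B (e k) (u a) * B (u a) (v j))"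
        by (rule add_sum_scale) (rule insert.hyps)
      also have "(\<Sum>a\<in>J. B (e k) (u a) * B (u a) (v j)) = 0"
        using orth_j by (intro sum.neutral) (simp add: commute)
      finally show ?thesis by simp
    qed
    have null_J: "B (res (insert j J) v k) (res (insert j J) v k) = 0" if "k \<in> J" for k
      using null[OF that] null_orthogonal[OF null[OF that], of "v j"] by (simp add: res_insert e_v)
    have "B (e j) (v j) = c * B z z"
      unfolding e_v commute[of "res J u j"] by (simp add: vj scale z_def)
    \<comment> \<open>The new residual is \<open>(1 - c\<^sup>2 * B z z) * z\<close>: zero if
      \<open>z\<close> has positive length, and the null vector \<open>z\<close> otherwise.\<close>
    then have "res (insert j J) v j = (\<lambda>i. z i + (- (c\<^sup>2 * B z z)) * z i)"
      by (simp add: res_insert z_def[symmetric]) (simp add: vj power2_eq_square algebra_simps)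
    then have null_j: "B (res (insert j J) v j) (res (insert j J) v j) = 0"
      by (simp only: expand_square cz) auto
    show ?case
    proof (intro exI[of _ v] conjI ballI impI)
      fix a b assume "a \<in> insert j J" "b \<in> insert j J" "a \<noteq> b"
      then show "B (v a) (v b) = 0" using orth orth_j by (auto simp: vJ commute[of _ "v j"])
    next
      fix a assume "a \<in> insert j J"
      then show "B (v a) (v a) \<in> {0, 1}" using unit[of a] unit_j vJ[of a] by (cases "a = j") auto
    next
      fix k assume "k \<in> insert j J"
      then show "B (res (insert j J) v k) (res (insert j J) v k) = 0" using null_J null_j by auto
    qed
  qed
  then obtain u where u: "(\<forall>a\<in>J. \<forall>b\<in>J. a \<noteq> b \<longrightarrow> B (u a) (u b) = 0) \<and>
      (\<forall>a\<in>J. B (u a) (u a) \<in> {0, 1}) \<and> (\<forall>j\<in>J. B (res J u j) (res J u j) = 0)"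
    by (elim exE)
  show thesis by (rule that[of u]) (use u in \<open>simp_all add: res_def\<close>)
qed

end

lemma psd_form_sum:
  assumes "finite F" "\<And>f. f \<in> F \<Longrightarrow> psd_form (A f)"
  shows "psd_form (\<lambda>x y. \<Sum>f\<in>F. A f x y)"
proof -
  have "A f (\<lambda>i. x i + c * y i) z = A f x z + c * A f y z" if "f \<in> F" for f x c y z
    using psd_form.add_scale[OF assms(2)[OF that]] .
  moreover have "A f x y = A f y x" if "f \<in> F" for f x y
    using psd_form.commute[OF assms(2)[OF that]] .
  moreover have "0 \<le> A f x x" if "f \<in> F" for f x
    using psd_form.nonneg[OF assms(2)[OF that]] .
  ultimately show ?thesis
    by unfold_locales (simp_all add: sum.distrib sum_distrib_left sum_nonneg)
qed

text \<open>Gram-Schmidt for the rows of \<open>R\<close>. That \<open>S\<close> lies in the row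
  space is expressed through annihilators, the form in which boundedness of the polytope supplies it
  later. The residual of \<open>S\<close> annihilates all rows, hence also \<open>S\<close>, and so
  has length zero.\<close>

lemma orthonormal_row_basis:
  fixes R :: "'j \<Rightarrow> 'i \<Rightarrow> real"
  assumes "finite F" "finite J"
  obtains u :: "'j \<Rightarrow> 'i \<Rightarrow> real"
  where "\<And>b f. b \<in> J \<Longrightarrow> f \<in> F \<Longrightarrow> \<bar>u b f\<bar> \<le> 1"
    and "\<And>S f. (\<And>z. (\<And>j. j \<in> J \<Longrightarrow> (\<Sum>g\<in>F. z g * R j g) = 0) \<Longrightarrow> (\<Sum>g\<in>F. z g * S g) = 0) \<Longrightarrow>
            f \<in> F \<Longrightarrow> S f = (\<Sum>b\<in>J. (\<Sum>g\<in>F. S g * u b g) * u b f)"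
proof -
  define B where "B x y = (\<Sum>f\<in>F. x f * y f)" for x y :: "'i \<Rightarrow> real"
  interpret psd_form B
    by unfold_locales (simp_all add: B_def algebra_simps sum.distrib sum_distrib_left sum_nonneg)
  have null: "x f = 0" if "B x x = 0" "f \<in> F" for x f
    using that assms by (simp add: B_def sum_nonneg_eq_0_iff)
  obtain u where orth: "\<And>a b. a \<in> J \<Longrightarrow> b \<in> J \<Longrightarrow> a \<noteq> b \<Longrightarrow> B (u a) (u b) = 0"
    and unit: "\<And>a. a \<in> J \<Longrightarrow> B (u a) (u a) \<in> {0, 1}"
    and res: "\<And>j. j \<in> J \<Longrightarrow> B (\<lambda>i. R j i - (\<Sum>a\<in>J. B (R j) (u a) * u a i))
                                  (\<lambda>i. R j i - (\<Sum>a\<in>J. B (R j) (u a) * u a i)) = 0"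
    using gram_schmidt[OF assms(2), of R] by blast
  show thesis
  proof (rule that)
    fix b f assume bf: "b \<in> J" "f \<in> F"
    have "(u b f)\<^sup>2 \<le> (\<Sum>f\<in>F. (u b f)\<^sup>2)"
      using bf assms by (intro member_le_sum) auto
    also have "\<dots> = B (u b) (u b)" by (simp add: B_def power2_eq_square)
    also have "\<dots> \<le> 1" using unit[OF bf(1)] by auto
    finally show "\<bar>u b f\<bar> \<le> 1" by (simp add: abs_square_le_1)
  next
    fix S f
    assume ann: "\<And>z. (\<And>j. j \<in> J \<Longrightarrow> (\<Sum>g\<in>F. z g * R j g) = 0) \<Longrightarrow> (\<Sum>g\<in>F. z g * S g) = 0"
      and f: "f \<in> F"
    define z where "z = (\<lambda>i. S i - (\<Sum>a\<in>J. B S (u a) * u a i))"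
    have zu: "B z (u b) = 0" if b: "b \<in> J" for b
    proof -
      have "B z (u b) = B S (u b) - (\<Sum>a\<in>J. B S (u a) * B (u a) (u b))"
        by (simp add: z_def diff_sum_scale assms)
      also have "(\<Sum>a\<in>J. B S (u a) * B (u a) (u b)) = (\<Sum>a\<in>J. if a = b then B S (u b) * B (u b) (u b) else 0)"
        using orth b by (intro sum.cong) auto
      also have "\<dots> = B S (u b)"
        using unit[OF b] null_orthogonal[of "u b" S] assms b by (auto simp: commute)
      finally show ?thesis by simp
    qed
    have span: "B (\<lambda>i. \<Sum>a\<in>J. c a * u a i) z = 0" for c
      unfolding sum_scale[OF assms(2)] using zu by (intro sum.neutral) (simp add: commute[of _ z])
    have "(\<Sum>g\<in>F. z g * R j g) = 0" if j: "j \<in> J" for j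
    proof -
      have "R j g = (\<Sum>a\<in>J. B (R j) (u a) * u a g)" if "g \<in> F" for g
        using null[OF res[OF j] that] by simp
      then have "(\<Sum>g\<in>F. z g * R j g) = B (\<lambda>i. \<Sum>a\<in>J. B (R j) (u a) * u a i) z"
        by (simp add: B_def mult.commute)
      then show ?thesis using span by simp
    qed
    then have "B S z = 0" using ann[of z] by (simp add: B_def mult.commute)
    then have "B z z = 0"
      using span by (simp add: z_def[symmetric] diff_sum_scale[OF assms(2), of S "\<lambda>a. B S (u a)" u z, folded z_def] sum_scale[OF assms(2)])
    from null[OF this f] show "S f = (\<Sum>b\<in>J. (\<Sum>g\<in>F. S g * u b g) * u b f)"
      by (simp add: z_def B_def)
  qed
qed

section \<open>Rounding of normalized lifts\<close>

lemma card_zero_one_points: "card (zero_one_points :: (real ^ 'd) set) = 2 ^ CARD('d)"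
proof -
  have "bij_betw vec_lambda (UNIV \<rightarrow>\<^sub>E {0, 1}) (zero_one_points :: (real ^ 'd) set)"
    by (rule bij_betwI[where g = vec_nth]) (auto simp: zero_one_points_def PiE_def Pi_def)
  then have "card (zero_one_points :: (real ^ 'd) set) = card ((UNIV :: 'd set) \<rightarrow>\<^sub>E {0, 1 :: real})"
    by (simp add: bij_betw_same_card)
  then show ?thesis by (simp add: card_PiE numeral_2_eq_2)
qed

text \<open>On the cube the distance to \<open>f\<close> in the sum norm is the affine function
  \<open>h\<close>, which is at least 1 at every other 0/1-point. Affinity extends this bound to the
  hull of \<open>F\<close>.\<close>

lemma zero_one_hull_distance:
  fixes F :: "(real ^ 'd) set"
  assumes F: "F \<subseteq> zero_one_points" and f: "f \<in> zero_one_points" "f \<notin> F"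
    and w: "w \<in> convex hull F"
  shows "1 \<le> (\<Sum>i\<in>UNIV. \<bar>w $ i - f $ i\<bar>)"
proof -
  define h where "h x = (\<Sum>i\<in>UNIV. if f $ i = 0 then x $ i else 1 - x $ i)" for x :: "real ^ 'd"
  have h_affine: "h (u *\<^sub>R x + v *\<^sub>R y) = u * h x + v * h y" if "u + v = 1" for u v x y
  proof -
    have "u = 1 - v" using that by simp
    then show ?thesis
      unfolding h_def sum_distrib_left sum.distrib[symmetric]
      by (intro sum.cong) (auto simp: algebra_simps)
  qed
  have "convex {x. 1 \<le> h x}"
    unfolding convex_def
  proof (intro ballI allI impI)
    fix x y :: "real ^ 'd" and u v :: real
    assume a: "x \<in> {x. 1 \<le> h x}" "y \<in> {x. 1 \<le> h x}" "0 \<le> u" "0 \<le> v" "u + v = 1"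
    have "u * 1 + v * 1 \<le> u * h x + v * h y" using a by (intro add_mono mult_left_mono) auto
    then show "u *\<^sub>R x + v *\<^sub>R y \<in> {x. 1 \<le> h x}" using a by (simp add: h_affine)
  qed
  moreover have "F \<subseteq> {x. 1 \<le> h x}"
  proof
    fix x assume x: "x \<in> F"
    then have "x \<noteq> f" using f by blast
    then obtain i where i: "x $ i \<noteq> f $ i" by (auto simp: Finite_Cartesian_Product.vec_eq_iff)
    have x01: "x $ j = 0 \<or> x $ j = 1" for j using F x by (auto simp: zero_one_points_def)
    then have x_nonneg: "0 \<le> x $ j" "x $ j \<le> 1" for j
      by (metis order_refl zero_le_one)+
    have f01: "f $ j = 0 \<or> f $ j = 1" for j using f by (auto simp: zero_one_points_def)
    have "1 = (if f $ i = 0 then x $ i else 1 - x $ i)"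
      using i x01[of i] f01[of i] by auto
    also have "\<dots> \<le> h x"
      unfolding h_def using x_nonneg by (intro member_le_sum) auto
    finally show "x \<in> {x. 1 \<le> h x}" by simp
  qed
  ultimately have "1 \<le> h w" using w hull_minimal[of F "{x. 1 \<le> h x}" convex] by auto
  also have "h w \<le> (\<Sum>i\<in>UNIV. \<bar>w $ i - f $ i\<bar>)"
    unfolding h_def using f by (intro sum_mono) (auto simp: zero_one_points_def)
  finally show ?thesis .
qed

text \<open>A 0/1-point of \<open>convex hull Z\<close> has distance 0 from itself, so
  \<open>zero_one_hull_distance\<close> puts it into \<open>Z\<close>.\<close>

lemma inj_on_convex_hull_zero_one:
  "inj_on (\<lambda>Y. convex hull Y) (Pow (zero_one_points :: (real ^ 'd) set))"
proof -
  have "Y \<subseteq> Z" if "Y \<subseteq> zero_one_points" "Z \<subseteq> zero_one_points" "convex hull Y = convex hull Z"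
    for Y Z :: "(real ^ 'd) set"
  proof
    fix f assume f: "f \<in> Y"
    then have "f \<in> convex hull Z" using that hull_inc[of f Y convex] by simp
    then show "f \<in> Z" using zero_one_hull_distance[of Z f f] that f by force
  qed
  then show ?thesis by (intro inj_onI) (simp, blast)
qed

text \<open>A common form of normalized linear and semidefinite descriptions of \<open>convex hull F\<close>:
  \<open>a f j\<close> are the coordinates of the lift of \<open>f\<close> in a space of matrices, and \<open>T\<close> consists of the
  linear functionals whose nonnegativity defines the cone. The set \<open>T\<close> is shared by all polytopes;
  \<open>test_normalized\<close> says that it is calibrated against the sum of all lifts.\<close>

locale normalized_lift =
  fixes J :: "'j set" and T :: "('j \<Rightarrow> real) set" and \<kappa> :: real
    and F :: "(real ^ 'd) set" and a :: "real ^ 'd \<Rightarrow> 'j \<Rightarrow> real"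
  assumes finite_J: "finite J"
    and points: "F \<subseteq> zero_one_points"
    and bounded_coords: "f \<in> F \<Longrightarrow> j \<in> J \<Longrightarrow> \<bar>a f j\<bar> \<le> 1"
    and test_nonneg: "f \<in> F \<Longrightarrow> t \<in> T \<Longrightarrow> 0 \<le> (\<Sum>j\<in>J. t j * a f j)"
    and test_normalized: "t \<in> T \<Longrightarrow> \<exists>s\<in>T. (\<forall>f\<in>F. (\<Sum>j\<in>J. s j * a f j) = (\<Sum>j\<in>J. t j * a f j)) \<and>
          (\<Sum>j\<in>J. \<bar>s j\<bar>) \<le> \<kappa> * (\<Sum>f\<in>F. \<Sum>j\<in>J. s j * a f j)"
    and lift_closed: "sum l F = 1 \<Longrightarrow> (\<And>t. t \<in> T \<Longrightarrow> 0 \<le> (\<Sum>f\<in>F. l f * (\<Sum>j\<in>J. t j * a f j)))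
          \<Longrightarrow> (\<Sum>f\<in>F. l f *\<^sub>R f) \<in> convex hull F"
begin

lemma finite_F: "finite F"
  using points finite_zero_one_points finite_subset by blast

lemma card_F: "card F \<le> 2 ^ CARD('d)"
  using card_mono[OF finite_zero_one_points points] by (simp add: card_zero_one_points)

text \<open>Otherwise the lifted set contains a line whose image in the polytope is unbounded.\<close>

lemma point_determined:
  assumes z: "sum z F = 0" "\<And>j. j \<in> J \<Longrightarrow> (\<Sum>f\<in>F. z f * a f j) = 0"
  shows "(\<Sum>f\<in>F. z f *\<^sub>R f) = 0"
proof (cases "F = {}")
  case False
  then obtain p where p: "p \<in> F" by blast
  define w where "w = (\<Sum>f\<in>F. z f *\<^sub>R f)"
  \<comment> \<open>Every test vanishes on \<open>z\<close>. Hence adding any real multiple of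
    \<open>z\<close> to the weights concentrated at \<open>p\<close> keeps all test values
    nonnegative.\<close>
  have ray: "p + c *\<^sub>R w \<in> convex hull F" for c
  proof -
    define l where "l f = (if f = p then 1 else 0) + c * z f" for f
    have "sum l F = 1"
      using p z(1) finite_F by (simp add: l_def sum.distrib sum_distrib_left[symmetric])
    moreover have "0 \<le> (\<Sum>f\<in>F. l f * (\<Sum>j\<in>J. t j * a f j))" if t: "t \<in> T" for t
    proof -
      have "(\<Sum>f\<in>F. z f * (\<Sum>j\<in>J. t j * a f j)) = (\<Sum>j\<in>J. t j * (\<Sum>f\<in>F. z f * a f j))"
        unfolding sum_distrib_left by (subst sum.swap) (simp add: algebra_simps)
      also have "\<dots> = 0" using z(2) by simp
      finally have "(\<Sum>f\<in>F. z f * (\<Sum>j\<in>J. t j * a f j)) = 0" .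
      moreover have "(\<Sum>f\<in>F. l f * (\<Sum>j\<in>J. t j * a f j)) =
          (\<Sum>f\<in>F. if f = p then \<Sum>j\<in>J. t j * a f j else 0) + c * (\<Sum>f\<in>F. z f * (\<Sum>j\<in>J. t j * a f j))"
        by (auto simp: l_def sum.distrib[symmetric] sum_distrib_left[of c] algebra_simps intro!: sum.cong)
      ultimately show ?thesis using test_nonneg[OF p t] p finite_F by simp
    qed
    moreover have "(\<Sum>f\<in>F. l f *\<^sub>R f) = p + c *\<^sub>R w"
    proof -
      have "(\<Sum>f\<in>F. l f *\<^sub>R f) = (\<Sum>f\<in>F. (if f = p then f else 0) + c *\<^sub>R (z f *\<^sub>R f))"
        by (intro sum.cong) (auto simp: l_def algebra_simps)
      then show ?thesis using p finite_F by (simp add: sum.distrib w_def scaleR_sum_right)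
    qed
    ultimately show ?thesis using lift_closed[of l] by simp
  qed
  have "bounded (convex hull F)"
    by (intro compact_imp_bounded finite_imp_compact_convex_hull finite_F)
  then obtain K where K: "\<And>x. x \<in> convex hull F \<Longrightarrow> norm x \<le> K"
    by (auto simp: bounded_iff)
  have "w = 0"
  proof (rule ccontr)
    assume "w \<noteq> 0"
    define c where "c = (K + norm p + 1) / norm w"
    have "0 \<le> K" using K[OF ray[of 0]] norm_ge_zero order_trans by blast
    then have "norm (c *\<^sub>R w) = K + norm p + 1"
      using \<open>w \<noteq> 0\<close> by (simp add: c_def)
    moreover have "norm (c *\<^sub>R w) \<le> norm (p + c *\<^sub>R w) + norm p"
      using norm_triangle_ineq4[of "p + c *\<^sub>R w" p] by simp
    ultimately show False using K[OF ray[of c]] by simp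
  qed
  then show ?thesis by (simp add: w_def)
qed simp

end

section \<open>Codes of lifts\<close>

fun lift_row :: "(real ^ 'd \<Rightarrow> 'j \<Rightarrow> real) \<Rightarrow> 'j option + 'd \<Rightarrow> real ^ 'd \<Rightarrow> real" where
  "lift_row a (Inl None) f = 1"
| "lift_row a (Inl (Some j)) f = a f j"
| "lift_row a (Inr i) f = f $ i"

text \<open>\<open>None\<close> indexes the row of ones. Coefficients annihilate it if they sum to
  0, so linear algebra with these rows also controls affine combinations.\<close>

definition affine_coords :: "'j set \<Rightarrow> 'j option set" where
  "affine_coords J = insert None (Some ` J)"

text \<open>For the orthonormal system \<open>u\<close> these inner products are the coefficients of
  row \<open>r\<close>. They alone form the code; it records neither \<open>u\<close> nor
  \<open>F\<close>.\<close>

definition code_entry ::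
  "(real ^ 'd) set \<Rightarrow> (real ^ 'd \<Rightarrow> 'j \<Rightarrow> real) \<Rightarrow> ('j option \<Rightarrow> real ^ 'd \<Rightarrow> real) \<Rightarrow>
     'j option + 'd \<Rightarrow> 'j option \<Rightarrow> real" where
  "code_entry F a u r b = (\<Sum>g\<in>F. lift_row a r g * u b g)"

text \<open>The functions \<open>u b\<close> arise by orthogonalizing the rows of the lift; the coordinates of the
  points need no basis vectors of their own, by \<open>point_determined\<close>.\<close>

locale coded_lift = normalized_lift J T \<kappa> F a
  for J :: "'j set" and T \<kappa> and F :: "(real ^ 'd) set" and a +
  fixes u :: "'j option \<Rightarrow> real ^ 'd \<Rightarrow> real"
  assumes bounded_basis: "b \<in> affine_coords J \<Longrightarrow> f \<in> F \<Longrightarrow> \<bar>u b f\<bar> \<le> 1"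
    and row_expansion: "r \<in> affine_coords J <+> UNIV \<Longrightarrow> f \<in> F \<Longrightarrow>
          lift_row a r f = (\<Sum>b\<in>affine_coords J. code_entry F a u r b * u b f)"

lemma finite_affine_coords: "finite J \<Longrightarrow> finite (affine_coords J)"
  by (simp add: affine_coords_def)

lemma card_affine_coords: "finite J \<Longrightarrow> card (affine_coords J) = card J + 1"
  by (simp add: affine_coords_def card_image)

context normalized_lift
begin

text \<open>The rows of point coordinates lie in the span of the other rows, because coefficients
  annihilating the latter annihilate the points by \<open>point_determined\<close>.\<close>

lemma ex_coded_lift: "\<exists>u. coded_lift J T \<kappa> F a u"
proof -
  note finA = finite_affine_coords[OF finite_J]
  show ?thesis
  proof (rule orthonormal_row_basis[OF finite_F finA, of "\<lambda>j. lift_row a (Inl j)"])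
    fix u
    assume le: "\<And>b f. b \<in> affine_coords J \<Longrightarrow> f \<in> F \<Longrightarrow> \<bar>u b f\<bar> \<le> 1"
      and span: "\<And>S f. (\<And>z. (\<And>j. j \<in> affine_coords J \<Longrightarrow> (\<Sum>g\<in>F. z g * lift_row a (Inl j) g) = 0) \<Longrightarrow> (\<Sum>g\<in>F. z g * S g) = 0) \<Longrightarrow>
            f \<in> F \<Longrightarrow> S f = (\<Sum>b\<in>affine_coords J. (\<Sum>g\<in>F. S g * u b g) * u b f)"
  show ?thesis
  proof (intro exI[of _ u], unfold_locales)
    fix r :: "'j option + 'd" and f assume r: "r \<in> affine_coords J <+> UNIV" and f: "f \<in> F"
    show "lift_row a r f = (\<Sum>b\<in>affine_coords J. code_entry F a u r b * u b f)"
      unfolding code_entry_def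
    proof (rule span[OF _ f])
      fix z assume z: "\<And>j. j \<in> affine_coords J \<Longrightarrow> (\<Sum>g\<in>F. z g * lift_row a (Inl j) g) = 0"
      show "(\<Sum>g\<in>F. z g * lift_row a r g) = 0"
      proof (cases r)
        case (Inl j)
        then show ?thesis using z r by auto
      next
        case (Inr i)
        have "sum z F = 0" using z[of None] by (simp add: affine_coords_def)
        moreover have "(\<Sum>f\<in>F. z f * a f j) = 0" if "j \<in> J" for j
          using z[of "Some j"] that by (simp add: affine_coords_def)
        ultimately have "(\<Sum>f\<in>F. z f *\<^sub>R f) = 0" by (rule point_determined)
        then have "(\<Sum>f\<in>F. z f *\<^sub>R f) $ i = 0" by simp
        then show ?thesis by (simp add: Inr)
      qed
    qed
  qed (use le in auto)
  qed
qed

end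

context coded_lift
begin

text \<open>An inner product of at most \<open>2 ^ CARD('d)\<close> terms, each of modulus at most
  1.\<close>

lemma abs_code_entry:
  assumes "b \<in> affine_coords J" "r \<in> affine_coords J <+> UNIV"
  shows "\<bar>code_entry F a u r b\<bar> \<le> 2 ^ CARD('d)"
proof -
  have row: "\<bar>lift_row a r g\<bar> \<le> 1" if g: "g \<in> F" for g
  proof -
    have "g $ i = 0 \<or> g $ i = 1" for i using g points by (auto simp: zero_one_points_def)
    then have "\<bar>g $ i\<bar> \<le> 1" for i by (metis abs_one abs_zero order_refl zero_le_one)
    then show ?thesis
      using assms(2) bounded_coords[OF g]
      by (cases "(a, r, g)" rule: lift_row.cases) (auto simp: affine_coords_def)
  qed
  have "\<bar>code_entry F a u r b\<bar> \<le> (\<Sum>g\<in>F. \<bar>lift_row a r g * u b g\<bar>)"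
    unfolding code_entry_def by (rule sum_abs)
  also have "\<dots> \<le> (\<Sum>g\<in>F. 1)"
    using row bounded_basis[OF assms(1)]
    by (intro sum_mono) (simp add: abs_mult mult_le_one)
  also have "\<dots> \<le> 2 ^ CARD('d)" using card_F by (simp flip: of_nat_power)
  finally show ?thesis .
qed

end

text \<open>Re-expanding the coefficients of \<open>f\<close> in the second system gives an approximate lift of \<open>f\<close>
  there; adding \<open>\<delta>\<close> times the sum of all lifts pushes it into the cone.\<close>

lemma close_codes_subset:
  fixes F F' :: "(real ^ 'd) set" and \<epsilon> :: real
  assumes "coded_lift J T \<kappa> F a u" "coded_lift J T \<kappa> F' a' u'"
    and close: "\<And>r b. r \<in> affine_coords J <+> UNIV \<Longrightarrow> b \<in> affine_coords J \<Longrightarrow>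
                  \<bar>code_entry F a u r b - code_entry F' a' u' r b\<bar> \<le> \<epsilon>"
    and eps: "0 \<le> \<epsilon>" and kappa: "0 \<le> \<kappa>"
    and small: "2 * CARD('d) * (2 * ((card J + 1) * \<epsilon>) + \<kappa> * ((card J + 1) * \<epsilon>) * 2 ^ CARD('d)) < 1"
  shows "F \<subseteq> F'"
proof
  fix f assume f: "f \<in> F"
  interpret L: coded_lift J T \<kappa> F a u by fact
  interpret L': coded_lift J T \<kappa> F' a' u' by fact
  \<comment> \<open>Each of the \<open>card J + 1\<close> basis functions adds at most
    \<open>\<epsilon>\<close> to the error of a row, so \<open>\<eta>\<close> bounds that error. A
    test \<open>s\<close> then becomes negative by at most \<open>\<eta>\<close> times the sum of
    its absolute values, and \<open>\<delta>\<close> is chosen to compensate this.\<close>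
  define \<eta> where "\<eta> = (card J + 1) * \<epsilon>"
  define \<delta> where "\<delta> = \<kappa> * \<eta>"
  define n where "n = real (card F')"
  define l where "l g = (\<Sum>b\<in>affine_coords J. u b f * u' b g)" for g
  have eta0: "0 \<le> \<eta>" "0 \<le> \<delta>" using eps kappa by (simp_all add: \<eta>_def \<delta>_def)
  have n: "0 \<le> n" "n \<le> 2 ^ CARD('d)" using L'.card_F by (simp_all add: n_def flip: of_nat_power)
  have approx: "\<bar>(\<Sum>g\<in>F'. l g * lift_row a' r g) - lift_row a r f\<bar> \<le> \<eta>"
    if r: "r \<in> affine_coords J <+> UNIV" for r
  proof -
    have "(\<Sum>g\<in>F'. l g * lift_row a' r g) = (\<Sum>b\<in>affine_coords J. u b f * code_entry F' a' u' r b)"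
      unfolding l_def code_entry_def sum_distrib_left sum_distrib_right
      by (subst sum.swap) (simp add: algebra_simps)
    then have "\<bar>(\<Sum>g\<in>F'. l g * lift_row a' r g) - lift_row a r f\<bar> =
        \<bar>\<Sum>b\<in>affine_coords J. u b f * (code_entry F' a' u' r b - code_entry F a u r b)\<bar>"
      using L.row_expansion[OF r f] by (simp add: sum_subtractf[symmetric] algebra_simps)
    also have "\<dots> \<le> (\<Sum>b\<in>affine_coords J. \<bar>u b f * (code_entry F' a' u' r b - code_entry F a u r b)\<bar>)"
      by (rule sum_abs)
    also have "\<dots> \<le> (\<Sum>b\<in>affine_coords J. \<epsilon>)"
    proof (rule sum_mono)
      fix b assume b: "b \<in> affine_coords J"
      have "\<bar>u b f\<bar> * \<bar>code_entry F' a' u' r b - code_entry F a u r b\<bar> \<le> 1 * \<epsilon>"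
        using L.bounded_basis[OF b f] close[OF r b] by (intro mult_mono) auto
      then show "\<bar>u b f * (code_entry F' a' u' r b - code_entry F a u r b)\<bar> \<le> \<epsilon>"
        by (simp add: abs_mult)
    qed
    also have "\<dots> = \<eta>" by (simp add: \<eta>_def card_affine_coords L.finite_J)
    finally show ?thesis .
  qed
  define m where "m g = l g + \<delta>" for g
  define S where "S = sum m F'"
  \<comment> \<open>The row of ones shows that the weights nearly sum to 1.\<close>
  have "\<bar>sum l F' - 1\<bar> \<le> \<eta>"
    using approx[of "Inl None"] by (auto simp: affine_coords_def)
  moreover have S_eq: "S = sum l F' + \<delta> * n"
    by (simp add: S_def m_def n_def sum.distrib)
  ultimately have S_bounds: "\<bar>S - 1 - \<delta> * n\<bar> \<le> \<eta>" by simp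
  \<comment> \<open>\<open>M\<close> bounds, in each coordinate, the deviation of the unnormalized
    combination from \<open>S\<close> times \<open>f\<close>.\<close>
  define M where "M = 2 * \<eta> + \<delta> * n"
  have "M \<le> 2 * \<eta> + \<kappa> * \<eta> * 2 ^ CARD('d)"
    unfolding M_def \<delta>_def[symmetric] using n eta0 by (intro add_left_mono mult_left_mono) auto
  then have "2 * CARD('d) * M \<le> 2 * CARD('d) * (2 * \<eta> + \<kappa> * \<eta> * 2 ^ CARD('d))"
    by (intro mult_left_mono) auto
  then have M1: "2 * CARD('d) * M < 1" using small unfolding \<eta>_def by linarith
  have dn: "0 \<le> \<delta> * n" using eta0 n by simp
  have M0: "0 \<le> M" using eta0 n by (simp add: M_def)
  have "2 * M \<le> 2 * CARD('d) * M"
    using M0 by (intro mult_right_mono) (auto simp: Suc_le_eq)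
  then have "2 * M < 1" using M1 by linarith
  moreover have "2 * \<eta> \<le> M" using dn by (simp add: M_def)
  ultimately have "4 * \<eta> < 1" by linarith
  then have S_half: "1 / 2 \<le> S"
    using S_bounds dn by linarith
  define w where "w = (\<Sum>g\<in>F'. (m g / S) *\<^sub>R g)"
  have "w \<in> convex hull F'"
    unfolding w_def
  proof (rule L'.lift_closed)
    show "(\<Sum>g\<in>F'. m g / S) = 1"
      using S_half by (simp add: S_def sum_divide_distrib[symmetric])
  next
    fix t assume t: "t \<in> T"
    \<comment> \<open>\<open>t\<close> may have large coefficients that no lift of a point of
      \<open>F'\<close> detects, and these would magnify the error. The calibrated \<open>s\<close>
      has the same values on \<open>F'\<close>, and it can be evaluated at the lift of
      \<open>f\<close> because \<open>T\<close> is shared.\<close>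
    obtain s where s: "s \<in> T" and st: "\<forall>g\<in>F'. (\<Sum>j\<in>J. s j * a' g j) = (\<Sum>j\<in>J. t j * a' g j)"
      and s_norm: "(\<Sum>j\<in>J. \<bar>s j\<bar>) \<le> \<kappa> * (\<Sum>g\<in>F'. \<Sum>j\<in>J. s j * a' g j)"
      using L'.test_normalized[OF t] by blast
    have "(\<Sum>g\<in>F'. m g * (\<Sum>j\<in>J. s j * a' g j)) =
        (\<Sum>g\<in>F'. l g * (\<Sum>j\<in>J. s j * a' g j)) + \<delta> * (\<Sum>g\<in>F'. \<Sum>j\<in>J. s j * a' g j)"
      by (simp add: m_def sum.distrib[symmetric] sum_distrib_left[of \<delta>] algebra_simps)
    also have "(\<Sum>g\<in>F'. l g * (\<Sum>j\<in>J. s j * a' g j)) = (\<Sum>j\<in>J. s j * (\<Sum>g\<in>F'. l g * a' g j))"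
      unfolding sum_distrib_left by (subst sum.swap) (simp add: algebra_simps)
    also have "\<dots> = (\<Sum>j\<in>J. s j * a f j) + (\<Sum>j\<in>J. s j * ((\<Sum>g\<in>F'. l g * a' g j) - a f j))"
      by (simp add: sum.distrib[symmetric] algebra_simps)
    finally have split: "(\<Sum>g\<in>F'. m g * (\<Sum>j\<in>J. s j * a' g j)) =
        (\<Sum>j\<in>J. s j * a f j) + (\<Sum>j\<in>J. s j * ((\<Sum>g\<in>F'. l g * a' g j) - a f j)) +
        \<delta> * (\<Sum>g\<in>F'. \<Sum>j\<in>J. s j * a' g j)" .
    have "\<bar>\<Sum>j\<in>J. s j * ((\<Sum>g\<in>F'. l g * a' g j) - a f j)\<bar> \<le> (\<Sum>j\<in>J. \<bar>s j * ((\<Sum>g\<in>F'. l g * a' g j) - a f j)\<bar>)"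
      by (rule sum_abs)
    also have "\<dots> \<le> (\<Sum>j\<in>J. \<bar>s j\<bar> * \<eta>)"
    proof (rule sum_mono)
      fix j assume "j \<in> J"
      then have "\<bar>(\<Sum>g\<in>F'. l g * a' g j) - a f j\<bar> \<le> \<eta>"
        using approx[of "Inl (Some j)"] by (auto simp: affine_coords_def)
      then show "\<bar>s j * ((\<Sum>g\<in>F'. l g * a' g j) - a f j)\<bar> \<le> \<bar>s j\<bar> * \<eta>"
        by (simp add: abs_mult mult_left_mono)
    qed
    also have "\<dots> = \<eta> * (\<Sum>j\<in>J. \<bar>s j\<bar>)" by (simp add: sum_distrib_left mult.commute)
    also have "\<dots> \<le> \<eta> * (\<kappa> * (\<Sum>g\<in>F'. \<Sum>j\<in>J. s j * a' g j))"
      using s_norm eta0 by (intro mult_left_mono)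
    also have "\<dots> = \<delta> * (\<Sum>g\<in>F'. \<Sum>j\<in>J. s j * a' g j)" by (simp add: \<delta>_def)
    finally have "0 \<le> (\<Sum>g\<in>F'. m g * (\<Sum>j\<in>J. s j * a' g j))"
      using split L.test_nonneg[OF f s] by linarith
    also have "\<dots> = (\<Sum>g\<in>F'. m g * (\<Sum>j\<in>J. t j * a' g j))" using st by simp
    finally have "0 \<le> (\<Sum>g\<in>F'. m g * (\<Sum>j\<in>J. t j * a' g j)) / S"
      using S_half by simp
    then show "0 \<le> (\<Sum>g\<in>F'. m g / S * (\<Sum>j\<in>J. t j * a' g j))"
      by (simp add: sum_divide_distrib)
  qed
  moreover have "(\<Sum>i\<in>UNIV. \<bar>w $ i - f $ i\<bar>) < 1"
  proof -
    have "\<bar>w $ i - f $ i\<bar> \<le> 2 * M" for i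
    proof -
      define G where "G = (\<Sum>g\<in>F'. g $ i)"
      define e where "e = (\<Sum>g\<in>F'. l g * g $ i) - f $ i"
      have e: "\<bar>e\<bar> \<le> \<eta>" using approx[of "Inr i"] by (auto simp: e_def)
      have f01: "f $ i = 0 \<or> f $ i = 1" using L.points f by (auto simp: zero_one_points_def)
      have g01: "0 \<le> g $ i \<and> g $ i \<le> 1" if "g \<in> F'" for g
      proof -
        have "g $ i = 0 \<or> g $ i = 1" using L'.points that by (auto simp: zero_one_points_def)
        then show ?thesis by (elim disjE) simp_all
      qed
      have G: "0 \<le> G" "G \<le> n"
        unfolding G_def n_def using g01 sum_bounded_above[of F' "\<lambda>g. g $ i" 1]
        by (auto intro: sum_nonneg)
      have dG: "0 \<le> \<delta> * G" "\<delta> * G \<le> \<delta> * n"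
        using G eta0 by (auto intro: mult_left_mono)
      have "w $ i = (\<Sum>g\<in>F'. m g * g $ i) / S"
        by (simp add: w_def sum_divide_distrib)
      also have "(\<Sum>g\<in>F'. m g * g $ i) = f $ i + e + \<delta> * G"
        by (simp add: m_def e_def G_def sum.distrib sum_distrib_left algebra_simps)
      finally have "w $ i - f $ i = (f $ i + e + \<delta> * G - f $ i * S) / S"
        using S_half by (simp add: field_simps)
      then have "\<bar>w $ i - f $ i\<bar> = \<bar>f $ i + e + \<delta> * G - f $ i * S\<bar> / S"
        using S_half by simp
      also have "\<dots> \<le> M / S"
      proof (rule divide_right_mono)
        show "\<bar>f $ i + e + \<delta> * G - f $ i * S\<bar> \<le> M"
        proof -
          \<comment> \<open>If \<open>f $ i\<close> is 1, then \<open>\<delta> * G\<close> is offset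
            by the part \<open>\<delta> * n\<close> of \<open>S - 1\<close>.\<close>
          have "f $ i + e + \<delta> * G - f $ i * S = e + \<delta> * G \<or>
              f $ i + e + \<delta> * G - f $ i * S = e + \<delta> * G - (S - 1)"
            using f01 by auto
          moreover have "\<bar>e + \<delta> * G\<bar> \<le> M"
            using e dG eta0 unfolding M_def by linarith
          moreover have "\<bar>e + \<delta> * G - (S - 1)\<bar> \<le> M"
            using e dG S_bounds unfolding M_def by linarith
          ultimately show ?thesis by (elim disjE) (simp_all only:)
        qed
      qed (use S_half in simp)
      also have "\<dots> \<le> M / (1 / 2)"
        using S_half M0 by (intro divide_left_mono) auto
      finally show ?thesis by simp
    qed
    then have "(\<Sum>i\<in>UNIV. \<bar>w $ i - f $ i\<bar>) \<le> (\<Sum>i\<in>(UNIV :: 'd set). 2 * M)"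
      by (intro sum_mono)
    then show ?thesis using M1 by simp
  qed
  ultimately show "f \<in> F'"
    using zero_one_hull_distance[OF L'.points, of f w] L.points f by force
qed

section \<open>Counting rounded codes\<close>

definition normalized_hulls :: "'j set \<Rightarrow> ('j \<Rightarrow> real) set \<Rightarrow> real \<Rightarrow> (real ^ 'd) set set" where
  "normalized_hulls J T \<kappa> = {convex hull F | F. \<exists>a. normalized_lift J T \<kappa> F a}"

text \<open>Entries are rounded down to multiples of \<open>1 / 4 ^ CARD('d)\<close>. Equal
  roundings mean close codes, and \<open>close_codes_subset\<close> in both directions gives equal
  vertex sets, so rounding is injective. The base counts integers of modulus at most
  \<open>8 ^ CARD('d)\<close>, the exponent the entries of a code.\<close>

lemma card_normalized_hulls:
  fixes J :: "'j set"
  assumes J: "finite J" and kappa: "0 \<le> \<kappa>"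
    and small: "2 * CARD('d) * (2 * ((card J + 1) / 4 ^ CARD('d)) + \<kappa> * ((card J + 1) / 4 ^ CARD('d)) * 2 ^ CARD('d)) < 1"
  shows "card (normalized_hulls J T \<kappa> :: (real ^ 'd) set set)
           \<le> (2 * 8 ^ CARD('d) + 1) ^ ((card J + 1) * (card J + 1 + CARD('d)))"
proof -
  define I where "I = (affine_coords J <+> (UNIV :: 'd set)) \<times> affine_coords J"
  define C where "C = I \<rightarrow>\<^sub>E {- (8 ^ CARD('d)) .. 8 ^ CARD('d) :: int}"
  have finI: "finite I" using J by (simp add: I_def finite_affine_coords)
  have "\<forall>P\<in>(normalized_hulls J T \<kappa> :: (real ^ 'd) set set). \<exists>F a u. P = convex hull F \<and> coded_lift J T \<kappa> F a u"
    unfolding normalized_hulls_def using normalized_lift.ex_coded_lift by blast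
  then obtain F a u where hull: "\<And>P. P \<in> normalized_hulls J T \<kappa> \<Longrightarrow> P = convex hull F P"
    and coded: "\<And>P :: (real ^ 'd) set. P \<in> normalized_hulls J T \<kappa> \<Longrightarrow> coded_lift J T \<kappa> (F P) (a P) (u P)"
    by metis
  define E where "E P r b = code_entry (F P) (a P) (u P) r b" for P r b
  define c where "c P = restrict (\<lambda>(r, b). \<lfloor>E P r b * 4 ^ CARD('d)\<rfloor>) I" for P
  have "c P \<in> C" if P: "P \<in> normalized_hulls J T \<kappa>" for P
    unfolding C_def
  proof (intro PiE_I)
    fix x assume x: "x \<in> I"
    then obtain r b where rb: "x = (r, b)" "r \<in> affine_coords J <+> UNIV" "b \<in> affine_coords J"
      by (auto simp: I_def)
    have "\<bar>E P r b\<bar> \<le> 2 ^ CARD('d)"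
      unfolding E_def using coded_lift.abs_code_entry[OF coded[OF P]] rb by blast
    then have "\<bar>E P r b\<bar> * 4 ^ CARD('d) \<le> 2 ^ CARD('d) * 4 ^ CARD('d)"
      by (intro mult_right_mono) auto
    then have "\<bar>E P r b * 4 ^ CARD('d)\<bar> \<le> 8 ^ CARD('d)"
      by (simp add: abs_mult power_mult_distrib[symmetric])
    then have "- (8 ^ CARD('d)) \<le> E P r b * 4 ^ CARD('d)" "E P r b * 4 ^ CARD('d) \<le> 8 ^ CARD('d)"
      by linarith+
    then have "- (8 ^ CARD('d)) \<le> \<lfloor>E P r b * 4 ^ CARD('d)\<rfloor>" "\<lfloor>E P r b * 4 ^ CARD('d)\<rfloor> \<le> 8 ^ CARD('d)"
      by (simp_all add: le_floor_iff floor_le_iff)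
    then show "c P x \<in> {- (8 ^ CARD('d)) .. 8 ^ CARD('d)}"
      using x rb by (simp add: c_def)
  qed (simp add: c_def)
  moreover have "inj_on c (normalized_hulls J T \<kappa>)"
  proof (rule inj_onI)
    fix P Q :: "(real ^ 'd) set"
    assume P: "P \<in> normalized_hulls J T \<kappa>" and Q: "Q \<in> normalized_hulls J T \<kappa>" and eq: "c P = c Q"
    have close: "\<bar>E P r b - E Q r b\<bar> \<le> 1 / 4 ^ CARD('d)"
      if rb: "r \<in> affine_coords J <+> UNIV" "b \<in> affine_coords J" for r b
    proof -
      have "c P (r, b) = c Q (r, b)" using eq by simp
      then have "\<lfloor>E P r b * 4 ^ CARD('d)\<rfloor> = \<lfloor>E Q r b * 4 ^ CARD('d)\<rfloor>"
        using rb by (simp add: c_def I_def)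
      then have "\<bar>E P r b * 4 ^ CARD('d) - E Q r b * 4 ^ CARD('d)\<bar> \<le> 1" by linarith
      then have "\<bar>(E P r b - E Q r b) * 4 ^ CARD('d)\<bar> \<le> 1" by (simp add: algebra_simps)
      then show ?thesis by (simp add: abs_mult pos_le_divide_eq)
    qed
    have sm: "2 * CARD('d) * (2 * ((card J + 1) * (1 / 4 ^ CARD('d))) + \<kappa> * ((card J + 1) * (1 / 4 ^ CARD('d))) * 2 ^ CARD('d)) < 1"
      using small by simp
    have "F P \<subseteq> F Q"
      by (rule close_codes_subset[OF coded[OF P] coded[OF Q] _ _ kappa sm])
        (use close in \<open>auto simp: E_def\<close>)
    moreover have "F Q \<subseteq> F P"
      by (rule close_codes_subset[OF coded[OF Q] coded[OF P] _ _ kappa sm])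
        (use close in \<open>auto simp: E_def abs_minus_commute\<close>)
    ultimately have "F P = F Q" by blast
    then show "P = Q" using hull[OF P] hull[OF Q] by simp
  qed
  moreover have "finite C" unfolding C_def using finI by (intro finite_PiE) auto
  ultimately have "card (normalized_hulls J T \<kappa> :: (real ^ 'd) set set) \<le> card C"
    by (intro card_inj_on_le[of c]) auto
  also have "card C = (2 * 8 ^ CARD('d) + 1) ^ card I"
    unfolding C_def using finI by (simp add: card_PiE nat_add_distrib nat_mult_distrib nat_power_eq)
  also have "card I = (card J + 1) * (card J + 1 + CARD('d))"
    using J by (simp add: I_def card_cartesian_product card_Plus finite_affine_coords card_affine_coords algebra_simps)
  finally show ?thesis .
qed

section \<open>Normalization of extended formulations\<close>

text \<open>Only binary combinations are given, and partial sums of the weights may vanish. The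
  induction therefore adds multiples of differences to a fixed base point \<open>p q\<close>,
  without renormalizing.\<close>

lemma ex_affine_combination:
  fixes g :: "'i \<Rightarrow> 'x \<Rightarrow> real"
  assumes closed: "\<And>x y t. x \<in> X \<Longrightarrow> y \<in> X \<Longrightarrow> comb t x y \<in> X"
    and g: "\<And>i x y t. i \<in> I \<Longrightarrow> x \<in> X \<Longrightarrow> y \<in> X \<Longrightarrow> g i (comb t x y) = (1 - t) * g i x + t * g i y"
    and F: "finite F" "\<And>f. f \<in> F \<Longrightarrow> p f \<in> X" and l: "sum l F = 1"
  shows "\<exists>x\<in>X. \<forall>i\<in>I. g i x = (\<Sum>f\<in>F. l f * g i (p f))"
proof -
  obtain q where q: "q \<in> F" using l by force
  have "\<exists>x\<in>X. \<forall>i\<in>I. g i x = g i (p q) + (\<Sum>f\<in>G. l f * (g i (p f) - g i (p q)))"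
    if "finite G" "G \<subseteq> F" for G
    using that
  proof induction
    case empty
    then show ?case using F q by auto
  next
    case (insert h G)
    then obtain x where x: "x \<in> X" "\<And>i. i \<in> I \<Longrightarrow> g i x = g i (p q) + (\<Sum>f\<in>G. l f * (g i (p f) - g i (p q)))"
      by auto
    \<comment> \<open>In affine terms \<open>comb 2 (p q) m\<close> is \<open>x + y - p q\<close>,
      that is, \<open>x\<close> shifted by \<open>l h\<close> times the difference of
      \<open>p h\<close> and \<open>p q\<close>.\<close>
    define y where "y = comb (l h) (p q) (p h)"
    define m where "m = comb (1 / 2) x y"
    have mem: "p q \<in> X" "p h \<in> X" using F q insert.prems by auto
    then have mem': "y \<in> X" "m \<in> X" using closed x unfolding y_def m_def by auto
    have "g i (comb 2 (p q) m) = g i (p q) + (\<Sum>f\<in>insert h G. l f * (g i (p f) - g i (p q)))"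
      if i: "i \<in> I" for i
    proof -
      have "g i (comb 2 (p q) m) = (1 - 2) * g i (p q) + 2 * g i m" using g i mem mem' by blast
      also have "g i m = (1 - 1 / 2) * g i x + 1 / 2 * g i y"
        unfolding m_def using g i x(1) mem' by blast
      also have "g i y = (1 - l h) * g i (p q) + l h * g i (p h)"
        unfolding y_def using g i mem by blast
      finally show ?thesis
        using insert.hyps by (simp add: x(2)[OF i] algebra_simps)
    qed
    then show ?case using closed[OF mem(1) mem'(2)] by blast
  qed
  from this[OF F(1)] obtain x where x: "x \<in> X"
    "\<And>i. i \<in> I \<Longrightarrow> g i x = g i (p q) + (\<Sum>f\<in>F. l f * (g i (p f) - g i (p q)))"
    by auto
  have "(\<Sum>f\<in>F. l f * (g i (p f) - g i (p q))) = (\<Sum>f\<in>F. l f * g i (p f)) - sum l F * g i (p q)" for i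
    by (simp add: algebra_simps sum_subtractf sum_distrib_right)
  then show ?thesis using x l by auto
qed

text \<open>The coordinates of \<open>\<phi>\<close> and the entries of \<open>M\<close> are merged
  into one family \<open>g\<close>, so that a single point \<open>x\<close> realizes both
  combinations.\<close>

lemma extended_formulation_affine_combination:
  fixes \<phi> :: "real Matrix.vec \<Rightarrow> real ^ 'd"
  assumes ext: "extended_formulation n k \<phi> M P"
    and F: "finite F" "\<And>f. f \<in> F \<Longrightarrow> p f \<in> carrier_vec n" and l: "sum l F = 1"
  obtains x where "x \<in> carrier_vec n" "\<phi> x = (\<Sum>f\<in>F. l f *\<^sub>R \<phi> (p f))"
    and "\<And>s t. s < k \<Longrightarrow> t < k \<Longrightarrow> M x $$ (s, t) = (\<Sum>f\<in>F. l f * M (p f) $$ (s, t))"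
proof -
  define g :: "'d + nat \<times> nat \<Rightarrow> real Matrix.vec \<Rightarrow> real" where
    "g i x = (case i of Inl i \<Rightarrow> \<phi> x $ i | Inr st \<Rightarrow> M x $$ st)" for i x
  have \<phi>: "\<phi> ((1 - t) \<cdot>\<^sub>v x + t \<cdot>\<^sub>v y) = (1 - t) *\<^sub>R \<phi> x + t *\<^sub>R \<phi> y"
    and M: "M ((1 - t) \<cdot>\<^sub>v x + t \<cdot>\<^sub>v y) = (1 - t) \<cdot>\<^sub>m M x + t \<cdot>\<^sub>m M y"
    and carrier: "M x \<in> carrier_mat k k"
    if "x \<in> carrier_vec n" "y \<in> carrier_vec n" for x y t
    using ext that
    by (auto simp: extended_formulation_def affine_point_map_def affine_matrix_map_def symmetric_mats_def)
  have "\<exists>x\<in>carrier_vec n. \<forall>i\<in>UNIV <+> {..<k} \<times> {..<k}. g i x = (\<Sum>f\<in>F. l f * g i (p f))"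
  proof (rule ex_affine_combination[where comb = "\<lambda>t x y. (1 - t) \<cdot>\<^sub>v x + t \<cdot>\<^sub>v y"])
    fix i and x y :: "real Matrix.vec" and t
    assume i: "i \<in> (UNIV :: 'd set) <+> {..<k} \<times> {..<k}"
      and xy: "x \<in> carrier_vec n" "y \<in> carrier_vec n"
    have "M x \<in> carrier_mat k k" "M y \<in> carrier_mat k k" using carrier xy by blast+
    then show "g i ((1 - t) \<cdot>\<^sub>v x + t \<cdot>\<^sub>v y) = (1 - t) * g i x + t * g i y"
      using i by (auto simp: g_def \<phi>[OF xy] M[OF xy] carrier_matD)
  qed (use F l in auto)
  then obtain x where x: "x \<in> carrier_vec n"
    and gx: "\<And>i. i \<in> UNIV <+> {..<k} \<times> {..<k} \<Longrightarrow> g i x = (\<Sum>f\<in>F. l f * g i (p f))"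
    by blast
  show thesis
  proof (rule that[OF x])
    show "\<phi> x = (\<Sum>f\<in>F. l f *\<^sub>R \<phi> (p f))"
      using gx[OF InlI[OF UNIV_I]] by (simp add: Finite_Cartesian_Product.vec_eq_iff g_def)
    show "M x $$ (s, t) = (\<Sum>f\<in>F. l f * M (p f) $$ (s, t))" if "s < k" "t < k" for s t
      using gx[of "Inr (s, t)"] that by (auto simp: g_def)
  qed
qed

section \<open>Quadratic forms and lifts of vertices\<close>

lemma quadratic_form_eq:
  fixes A :: "real mat"
  assumes "A \<in> carrier_mat k k" "v \<in> carrier_vec k"
  shows "scalar_prod v (A *\<^sub>v v) = (\<Sum>s<k. \<Sum>t<k. vec_index v s * vec_index v t * A $$ (s, t))"
  using assms
  by (simp add: scalar_prod_def atLeast0LessThan sum_distrib_left mult_ac)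

lemma psd_cone_iff:
  "A \<in> psd_cone k \<longleftrightarrow> A \<in> symmetric_mats k \<and>
     (\<forall>y :: nat \<Rightarrow> real. 0 \<le> (\<Sum>s<k. \<Sum>t<k. y s * y t * A $$ (s, t)))"
proof (cases "A \<in> symmetric_mats k")
  case True
  then have A: "A \<in> carrier_mat k k" by (simp add: symmetric_mats_def)
  have "(\<forall>v\<in>carrier_vec k. 0 \<le> scalar_prod v (A *\<^sub>v v)) \<longleftrightarrow>
      (\<forall>y :: nat \<Rightarrow> real. 0 \<le> (\<Sum>s<k. \<Sum>t<k. y s * y t * A $$ (s, t)))"
  proof (intro iffI allI ballI)
    fix y :: "nat \<Rightarrow> real"
    assume "\<forall>v\<in>carrier_vec k. 0 \<le> scalar_prod v (A *\<^sub>v v)"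
    then have "0 \<le> scalar_prod (Matrix.vec k y) (A *\<^sub>v Matrix.vec k y)" by simp
    then show "0 \<le> (\<Sum>s<k. \<Sum>t<k. y s * y t * A $$ (s, t))"
      by (simp add: quadratic_form_eq[OF A])
  next
    fix v :: "real Matrix.vec" assume "\<forall>y :: nat \<Rightarrow> real. 0 \<le> (\<Sum>s<k. \<Sum>t<k. y s * y t * A $$ (s, t))"
      and "v \<in> carrier_vec k"
    then show "0 \<le> scalar_prod v (A *\<^sub>v v)" by (simp add: quadratic_form_eq[OF A])
  qed
  then show ?thesis using True by (simp add: psd_cone_def)
qed (simp add: psd_cone_def)

lemma symmetric_mats_swap:
  assumes "A \<in> symmetric_mats k" "s < k" "t < k"
  shows "A $$ (s, t) = A $$ (t, s)"
proof -
  have "dim_row A = k" "dim_col A = k" and tr: "transpose_mat A = A"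
    using assms(1) by (auto simp: symmetric_mats_def)
  then have "transpose_mat A $$ (s, t) = A $$ (t, s)" using assms(2,3) by (intro index_transpose_mat) auto
  then show ?thesis by (simp add: tr)
qed

lemma ex_lifts:
  assumes "extended_formulation n k \<phi> M (convex hull F)"
  obtains p where "\<And>f. f \<in> F \<Longrightarrow> p f \<in> carrier_vec n" "\<And>f. f \<in> F \<Longrightarrow> M (p f) \<in> psd_cone k"
    and "\<And>f. f \<in> F \<Longrightarrow> \<phi> (p f) = f"
proof -
  have "\<exists>x. x \<in> carrier_vec n \<and> M x \<in> psd_cone k \<and> \<phi> x = f" if "f \<in> F" for f
  proof -
    have "f \<in> convex hull F" using that by (rule hull_inc)
    then have "f \<in> \<phi> ` {x \<in> carrier_vec n. M x \<in> psd_cone k}"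
      using assms unfolding extended_formulation_def by blast
    then show ?thesis by blast
  qed
  then show thesis using that by metis
qed

text \<open>The matrices \<open>y y^T\<close>, whose pairings with a symmetric matrix decide whether
  it is positive semidefinite. They are not tied to a size, so one set serves every
  \<open>k\<close>.\<close>

definition quadratic_tests :: "(nat \<times> nat \<Rightarrow> real) set" where
  "quadratic_tests = range (\<lambda>y (s, t). y s * y t)"

lemma (in psd_form) quadratic_sum:
  assumes "finite J"
  shows "B (\<lambda>i. \<Sum>a\<in>J. c a * u a i) (\<lambda>i. \<Sum>a\<in>J. c a * u a i) =
         (\<Sum>(a, b)\<in>J \<times> J. c a * c b * B (u a) (u b))"
proof -
  have "B (u a) (\<lambda>i. \<Sum>b\<in>J. c b * u b i) = (\<Sum>b\<in>J. c b * B (u a) (u b))" for a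
    unfolding commute[of "u a"] by (rule sum_scale[OF assms])
  then show ?thesis
    by (simp add: sum_scale[OF assms] sum.cartesian_product[symmetric] sum_distrib_left mult.assoc)
qed

text \<open>The matrices are written in a basis that is orthonormal for the sum \<open>B\<close> of all lifts. Since the
  lifts are positive semidefinite, they vanish on the kernel of \<open>B\<close>, and their entries become
  bounded by 1. Extensions of size less than \<open>k\<close> are padded with zeros.\<close>

lemma LMI_normalized_lift:
  fixes F :: "(real ^ 'd) set"
  assumes ext: "has_LMI_extension k' (convex hull F)" and k: "k' \<le> k" and F: "F \<subseteq> zero_one_points"
  shows "\<exists>a. normalized_lift ({..<k} \<times> {..<k}) quadratic_tests (real k) F a"
proof -
  obtain n \<phi> M where ext: "extended_formulation n k' \<phi> M (convex hull F)"
    using ext unfolding has_LMI_extension_def by blast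
  obtain p where p: "\<And>f. f \<in> F \<Longrightarrow> p f \<in> carrier_vec n" "\<And>f. f \<in> F \<Longrightarrow> M (p f) \<in> psd_cone k'"
    "\<And>f. f \<in> F \<Longrightarrow> \<phi> (p f) = f"
    using ex_lifts[OF ext] by blast
  have finF: "finite F" using F finite_zero_one_points finite_subset by blast
  \<comment> \<open>\<open>A f\<close> reads only coordinates below \<open>k'\<close>, which amounts
    to padding with zeros up to \<open>k\<close>.\<close>
  define A where "A f x y = (\<Sum>s<k'. \<Sum>t<k'. x s * y t * M (p f) $$ (s, t))" for f x y
  have psd_A: "psd_form (A f)" if f: "f \<in> F" for f
  proof
    have sym: "M (p f) \<in> symmetric_mats k'" using p(2)[OF f] by (simp add: psd_cone_iff)
    fix x y z :: "nat \<Rightarrow> real" and c :: real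
    show "A f (\<lambda>i. x i + c * y i) z = A f x z + c * A f y z"
      by (simp add: A_def algebra_simps sum.distrib sum_distrib_left)
    have "A f x y = (\<Sum>t<k'. \<Sum>s<k'. x s * y t * M (p f) $$ (s, t))"
      unfolding A_def by (rule sum.swap)
    also have "\<dots> = A f y x"
      unfolding A_def by (intro sum.cong) (auto simp: symmetric_mats_swap[OF sym])
    finally show "A f x y = A f y x" .
    show "0 \<le> A f x x" using p(2)[OF f] by (simp add: A_def psd_cone_iff)
  qed
  define B where "B x y = (\<Sum>f\<in>F. A f x y)" for x y
  interpret B: psd_form B
    unfolding B_def using finF psd_A by (rule psd_form_sum)
  have A_le: "A f x x \<le> B x x" if "f \<in> F" for f x
    unfolding B_def using finF that psd_form.nonneg[OF psd_A] by (intro member_le_sum) auto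
  have A_null: "A f x x = 0" if "f \<in> F" "B x x = 0" for f x
    using A_le[OF that(1), of x] psd_form.nonneg[OF psd_A[OF that(1)], of x] that(2) by simp
  define e :: "nat \<Rightarrow> nat \<Rightarrow> real" where "e s i = (if i = s then 1 else 0)" for s i
  define res where "res u s = (\<lambda>i. e s i - (\<Sum>b<k. B (e s) (u b) * u b i))" for u s
  obtain u where orth: "\<And>s t. s < k \<Longrightarrow> t < k \<Longrightarrow> s \<noteq> t \<Longrightarrow> B (u s) (u t) = 0"
    and unit: "\<And>s. s < k \<Longrightarrow> B (u s) (u s) \<in> {0, 1}"
    and null: "\<And>s. s < k \<Longrightarrow> B (res u s) (res u s) = 0"
    using B.gram_schmidt[of "{..<k}" e] unfolding res_def by auto
  define U where "U y = (\<lambda>i. \<Sum>s<k. y s * u s i)" for y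
  define a where "a f = (\<lambda>(s, t). A f (u s) (u t))" for f
  have quad: "(\<Sum>j\<in>{..<k} \<times> {..<k}. (\<lambda>(s, t). y s * y t) j * a f j) = A f (U y) (U y)"
    if "f \<in> F" for y f
    unfolding U_def a_def psd_form.quadratic_sum[OF psd_A[OF that], OF finite_lessThan]
    by (intro sum.cong) auto
  show ?thesis
  proof (intro exI[of _ a], unfold_locales)
    show "F \<subseteq> zero_one_points" by fact
  next
    fix f j assume f: "f \<in> F" and j: "j \<in> {..<k} \<times> {..<k}"
    have "A f (u s) (u s) \<le> 1" if "s < k" for s
      using A_le[OF f, of "u s"] unit[OF that] by auto
    then show "\<bar>a f j\<bar> \<le> 1"
      using j psd_form.abs_le_one[OF psd_A[OF f]] by (auto simp: a_def)
  next
    fix f and t :: "nat \<times> nat \<Rightarrow> real" assume f: "f \<in> F" and t: "t \<in> quadratic_tests"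
    then obtain y where "t = (\<lambda>(s, t). y s * y t)" unfolding quadratic_tests_def by blast
    then show "0 \<le> (\<Sum>j\<in>{..<k} \<times> {..<k}. t j * a f j)"
      using quad[OF f] psd_form.nonneg[OF psd_A[OF f]] by simp
  next
    fix t :: "nat \<times> nat \<Rightarrow> real" assume "t \<in> quadratic_tests"
    then obtain y where y: "t = (\<lambda>(s, t). y s * y t)" unfolding quadratic_tests_def by blast
    \<comment> \<open>Coefficients of null vectors of the system change no test value but can be
      arbitrarily large; \<open>y'\<close> sets them to zero.\<close>
    define y' where "y' s = (if B (u s) (u s) = 0 then 0 else y s)" for s
    define z where "z = (\<lambda>i. \<Sum>s<k. y s * (if B (u s) (u s) = 0 then u s i else 0))"
    have z: "B z z = 0"
      unfolding z_def
    proof (rule B.sum_null)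
      fix s
      show "B (\<lambda>i. if B (u s) (u s) = 0 then u s i else 0) (\<lambda>i. if B (u s) (u s) = 0 then u s i else 0) = 0"
        using B.zero by (cases "B (u s) (u s) = 0") simp_all
    qed simp
    have Uy: "U y = (\<lambda>i. U y' i + z i)"
      by (auto simp: fun_eq_iff U_def z_def y'_def sum.distrib[symmetric] intro!: sum.cong)
    have U_eq: "A f (U y) (U y) = A f (U y') (U y')" if f: "f \<in> F" for f
      unfolding Uy by (rule psd_form.add_null[OF psd_A[OF f], OF A_null[OF f z]])
    define s where "s = (\<lambda>(i, j). y' i * y' j)"
    have "(\<Sum>j\<in>{..<k} \<times> {..<k}. \<bar>s j\<bar>) = (\<Sum>i<k. \<bar>y' i\<bar>)\<^sup>2"
      by (simp add: s_def sum.cartesian_product' abs_mult power2_eq_square sum_product)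
    \<comment> \<open>Cauchy-Schwarz over \<open>k\<close> coordinates is the source of the
      calibration constant \<open>real k\<close>.\<close>
    also have "\<dots> \<le> (\<Sum>i<k. \<bar>y' i\<bar>\<^sup>2) * real (card {..<k})"
      by (rule sum_squared_le_sum_of_squares)
    also have "\<dots> = real k * (\<Sum>i<k. (y' i)\<^sup>2)" by simp
    \<comment> \<open>The vectors retained by \<open>y'\<close> are orthonormal for
      \<open>B\<close>.\<close>
    also have "(\<Sum>i<k. (y' i)\<^sup>2) = B (U y') (U y')"
    proof -
      have "B (U y') (U y') = (\<Sum>i<k. \<Sum>j<k. y' i * y' j * B (u i) (u j))"
        by (simp add: U_def B.quadratic_sum sum.cartesian_product)
      also have "\<dots> = (\<Sum>i<k. \<Sum>j<k. if j = i then (y' i)\<^sup>2 else 0)"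
        using orth unit by (intro sum.cong) (auto simp: y'_def power2_eq_square)
      finally show ?thesis by simp
    qed
    also have "B (U y') (U y') = (\<Sum>f\<in>F. \<Sum>j\<in>{..<k} \<times> {..<k}. s j * a f j)"
      unfolding B_def s_def using quad by simp
    finally have norm: "(\<Sum>j\<in>{..<k} \<times> {..<k}. \<bar>s j\<bar>) \<le> real k * (\<Sum>f\<in>F. \<Sum>j\<in>{..<k} \<times> {..<k}. s j * a f j)" .
    have "s \<in> quadratic_tests" by (auto simp: s_def quadratic_tests_def)
    moreover have "\<forall>f\<in>F. (\<Sum>j\<in>{..<k} \<times> {..<k}. s j * a f j) = (\<Sum>j\<in>{..<k} \<times> {..<k}. t j * a f j)"
      using quad U_eq by (simp add: s_def y)
    ultimately show "\<exists>s\<in>quadratic_tests.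
        (\<forall>f\<in>F. (\<Sum>j\<in>{..<k} \<times> {..<k}. s j * a f j) = (\<Sum>j\<in>{..<k} \<times> {..<k}. t j * a f j)) \<and>
        (\<Sum>j\<in>{..<k} \<times> {..<k}. \<bar>s j\<bar>) \<le> real k * (\<Sum>f\<in>F. \<Sum>j\<in>{..<k} \<times> {..<k}. s j * a f j)"
      using norm by blast
  next
    fix l assume l: "sum l F = 1"
      and tests: "\<And>t. t \<in> quadratic_tests \<Longrightarrow> 0 \<le> (\<Sum>f\<in>F. l f * (\<Sum>j\<in>{..<k} \<times> {..<k}. t j * a f j))"
    obtain x where x: "x \<in> carrier_vec n" "\<phi> x = (\<Sum>f\<in>F. l f *\<^sub>R \<phi> (p f))"
      and Mx: "\<And>s t. s < k' \<Longrightarrow> t < k' \<Longrightarrow> M x $$ (s, t) = (\<Sum>f\<in>F. l f * M (p f) $$ (s, t))"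
      using extended_formulation_affine_combination[where p = p, OF ext finF p(1) l] by blast
    have "0 \<le> (\<Sum>s<k'. \<Sum>t<k'. v s * v t * M x $$ (s, t))" for v
    proof -
      \<comment> \<open>On the coordinates below \<open>k'\<close>, \<open>v\<close> equals
        \<open>U y\<close> up to a null vector, so the form of \<open>M x\<close> at
        \<open>v\<close> is a value controlled by the tests.\<close>
      define y where "y b = (\<Sum>s<k. v s * B (e s) (u b))" for b
      define z where "z = (\<lambda>i. \<Sum>s<k. v s * res u s i)"
      have z: "B z z = 0" unfolding z_def by (rule B.sum_null) (use null in auto)
      have v: "v i = U y i + z i" if "i < k'" for i
      proof -
        have "z i = (\<Sum>s<k. v s * e s i) - (\<Sum>s<k. \<Sum>b<k. v s * (B (e s) (u b) * u b i))"
          by (simp add: z_def res_def right_diff_distrib sum_subtractf sum_distrib_left)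
        also have "(\<Sum>s<k. v s * e s i) = v i" using that k by (simp add: e_def if_distrib cong: if_cong)
        also have "(\<Sum>s<k. \<Sum>b<k. v s * (B (e s) (u b) * u b i)) = U y i"
          unfolding U_def y_def sum_distrib_right by (subst sum.swap) (simp add: mult.assoc)
        finally show ?thesis by simp
      qed
      have A_v: "A f v v = A f (U y) (U y)" if f: "f \<in> F" for f
      proof -
        have "A f v v = A f (\<lambda>i. U y i + z i) (\<lambda>i. U y i + z i)"
          unfolding A_def by (intro sum.cong) (auto simp: v)
        also have "\<dots> = A f (U y) (U y)"
          by (rule psd_form.add_null[OF psd_A[OF f], OF A_null[OF f z]])
        finally show ?thesis .
      qed
      have "(\<Sum>s<k'. \<Sum>t<k'. v s * v t * M x $$ (s, t)) = (\<Sum>s<k'. \<Sum>t<k'. \<Sum>f\<in>F. l f * (v s * v t * M (p f) $$ (s, t)))"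
        by (intro sum.cong) (auto simp: Mx sum_distrib_left mult_ac)
      also have "\<dots> = (\<Sum>s<k'. \<Sum>f\<in>F. \<Sum>t<k'. l f * (v s * v t * M (p f) $$ (s, t)))"
        by (intro sum.cong refl sum.swap)
      also have "\<dots> = (\<Sum>f\<in>F. \<Sum>s<k'. \<Sum>t<k'. l f * (v s * v t * M (p f) $$ (s, t)))"
        by (rule sum.swap)
      also have "\<dots> = (\<Sum>f\<in>F. l f * A f v v)" by (simp add: A_def sum_distrib_left)
      also have "\<dots> = (\<Sum>f\<in>F. l f * (\<Sum>j\<in>{..<k} \<times> {..<k}. (\<lambda>(s, t). y s * y t) j * a f j))"
        using A_v quad by simp
      also have "\<dots> \<ge> 0" by (rule tests) (simp add: quadratic_tests_def)
      finally show ?thesis .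
    qed
    moreover have "M x \<in> symmetric_mats k'"
      using ext x(1) by (simp add: extended_formulation_def affine_matrix_map_def)
    ultimately have "\<phi> x \<in> convex hull F"
      using ext x(1) unfolding extended_formulation_def by (auto simp: psd_cone_iff)
    then show "(\<Sum>f\<in>F. l f *\<^sub>R f) \<in> convex hull F" using x(2) p(3) by simp
  qed simp
qed

section \<open>Linear inequalities\<close>

definition coordinate_tests :: "(nat \<Rightarrow> real) set" where
  "coordinate_tests = insert (\<lambda>_. 0) (range (\<lambda>s j. if j = s then 1 else 0))"

lemma quadratic_form_diagonal:
  fixes A :: "real mat"
  assumes "A \<in> carrier_mat k k" "diagonal_mat A"
  shows "(\<Sum>s<k. \<Sum>t<k. y s * y t * A $$ (s, t)) = (\<Sum>s<k. (y s)\<^sup>2 * A $$ (s, s))"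
proof -
  have "(\<Sum>s<k. \<Sum>t<k. y s * y t * A $$ (s, t)) = (\<Sum>s<k. \<Sum>t<k. if t = s then (y s)\<^sup>2 * A $$ (s, s) else 0)"
    using assms by (intro sum.cong) (auto simp: diagonal_mat_def power2_eq_square)
  then show ?thesis by simp
qed

lemma diagonal_psd_cone_iff:
  assumes "A \<in> symmetric_mats k" "diagonal_mat A"
  shows "A \<in> psd_cone k \<longleftrightarrow> (\<forall>s<k. 0 \<le> A $$ (s, s))"
proof -
  have A: "A \<in> carrier_mat k k" using assms by (simp add: symmetric_mats_def)
  have "(\<forall>y :: nat \<Rightarrow> real. 0 \<le> (\<Sum>s<k. (y s)\<^sup>2 * A $$ (s, s))) \<longleftrightarrow> (\<forall>s<k. 0 \<le> A $$ (s, s))"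
  proof (intro iffI allI impI)
    fix s assume nonneg: "\<forall>y :: nat \<Rightarrow> real. 0 \<le> (\<Sum>s<k. (y s)\<^sup>2 * A $$ (s, s))" and s: "s < k"
    have "(\<Sum>t<k. (if t = s then 1 else 0)\<^sup>2 * A $$ (t, t)) = (\<Sum>t<k. if t = s then A $$ (s, s) else 0)"
      by (intro sum.cong) auto
    then show "0 \<le> A $$ (s, s)" using nonneg[rule_format, of "\<lambda>t. if t = s then 1 else 0"] s by simp
  qed (auto intro: sum_nonneg)
  then show ?thesis using assms by (simp add: psd_cone_iff quadratic_form_diagonal[OF A])
qed

text \<open>Every inequality is scaled so that its slacks sum to 1 over the vertices, which yields
  the calibration constant 1. The zero functional in \<open>coordinate_tests\<close> stands in for
  coordinates at which all slacks vanish and for those outside \<open>{..<k}\<close>.\<close>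

lemma linear_normalized_lift:
  fixes F :: "(real ^ 'd) set"
  assumes ext: "has_linear_extension k' (convex hull F)" and k: "k' \<le> k" and F: "F \<subseteq> zero_one_points"
  shows "\<exists>a. normalized_lift {..<k} coordinate_tests 1 F a"
proof -
  obtain n \<phi> M where ext: "extended_formulation n k' \<phi> M (convex hull F)"
    and diag: "\<And>x. x \<in> carrier_vec n \<Longrightarrow> diagonal_mat (M x)"
    using ext unfolding has_linear_extension_def by blast
  have sym: "M x \<in> symmetric_mats k'" if "x \<in> carrier_vec n" for x
    using ext that by (simp add: extended_formulation_def affine_matrix_map_def)
  obtain p where p: "\<And>f. f \<in> F \<Longrightarrow> p f \<in> carrier_vec n" "\<And>f. f \<in> F \<Longrightarrow> M (p f) \<in> psd_cone k'"
    "\<And>f. f \<in> F \<Longrightarrow> \<phi> (p f) = f"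
    using ex_lifts[OF ext] by blast
  have finF: "finite F" using F finite_zero_one_points finite_subset by blast
  define m where "m f s = (if s < k' then M (p f) $$ (s, s) else 0)" for f s
  define B where "B s = (\<Sum>f\<in>F. m f s)" for s
  \<comment> \<open>Where all slacks vanish, division by zero gives the intended value 0.\<close>
  define a where "a f s = m f s / B s" for f s
  have m0: "0 \<le> m f s" if "f \<in> F" for f s
    using p(2)[OF that] diagonal_psd_cone_iff[OF sym diag, OF p(1) p(1), OF that that] by (simp add: m_def)
  have m_le: "m f s \<le> B s" if "f \<in> F" for f s
    unfolding B_def using finF m0 that by (intro member_le_sum) auto
  have B0: "0 \<le> B s" for s unfolding B_def using m0 by (intro sum_nonneg)
  have m_eq: "m f s = B s * a f s" if "f \<in> F" for f s
    using m_le[OF that, of s] m0[OF that, of s] by (auto simp: a_def)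
  have test_unit: "(\<Sum>j<k. (if j = s then 1 else 0) * a f j) = (if s < k then a f s else 0)" for s f
    by (simp add: if_distrib[of "\<lambda>x. x * _"] cong: if_cong)
  have sum_a: "(\<Sum>f\<in>F. a f s) = (if B s = 0 then 0 else 1)" for s
    by (simp add: a_def B_def sum_divide_distrib[symmetric])
  show ?thesis
  proof (intro exI[of _ a], unfold_locales)
    show "F \<subseteq> zero_one_points" by fact
  next
    fix f j assume f: "f \<in> F"
    show "\<bar>a f j\<bar> \<le> 1"
      using m_le[OF f, of j] m0[OF f, of j] by (auto simp: a_def divide_le_eq_1)
  next
    fix f and t :: "nat \<Rightarrow> real" assume f: "f \<in> F" and t: "t \<in> coordinate_tests"
    then show "0 \<le> (\<Sum>j<k. t j * a f j)"
      using m0[OF f] B0 unfolding coordinate_tests_def by (auto simp: test_unit) (simp add: a_def)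
  next
    fix t :: "nat \<Rightarrow> real" assume t: "t \<in> coordinate_tests"
    show "\<exists>s\<in>coordinate_tests. (\<forall>f\<in>F. (\<Sum>j<k. s j * a f j) = (\<Sum>j<k. t j * a f j)) \<and>
        (\<Sum>j<k. \<bar>s j\<bar>) \<le> 1 * (\<Sum>f\<in>F. \<Sum>j<k. s j * a f j)"
    proof (cases "\<exists>s<k. B s \<noteq> 0 \<and> t = (\<lambda>j. if j = s then 1 else 0)")
      case True
      then obtain s where s: "s < k" "B s \<noteq> 0" "t = (\<lambda>j. if j = s then 1 else 0)" by blast
      have "(\<Sum>j<k. \<bar>t j\<bar>) = 1" using s by (simp add: if_distrib cong: if_cong)
      moreover have "(\<Sum>f\<in>F. \<Sum>j<k. t j * a f j) = 1" using s by (simp add: test_unit sum_a)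
      ultimately show ?thesis using t by (intro bexI[of _ t]) auto
    next
      case False
      have "(\<Sum>j<k. t j * a f j) = 0" for f
      proof (cases "t = (\<lambda>_. 0)")
        case nonzero: False
        then obtain s where s: "t = (\<lambda>j. if j = s then 1 else 0)"
          using t by (auto simp: coordinate_tests_def)
        then have "s < k \<Longrightarrow> B s = 0" using False by blast
        then show ?thesis unfolding s test_unit by (simp add: a_def)
      qed simp
      then show ?thesis by (intro bexI[of _ "\<lambda>_. 0"]) (auto simp: coordinate_tests_def)
    qed
  next
    fix l assume l: "sum l F = 1"
      and tests: "\<And>t. t \<in> coordinate_tests \<Longrightarrow> 0 \<le> (\<Sum>f\<in>F. l f * (\<Sum>j<k. t j * a f j))"
    obtain x where x: "x \<in> carrier_vec n" "\<phi> x = (\<Sum>f\<in>F. l f *\<^sub>R \<phi> (p f))"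
      and Mx: "\<And>s t. s < k' \<Longrightarrow> t < k' \<Longrightarrow> M x $$ (s, t) = (\<Sum>f\<in>F. l f * M (p f) $$ (s, t))"
      using extended_formulation_affine_combination[where p = p, OF ext finF p(1) l] by blast
    have "0 \<le> M x $$ (s, s)" if s: "s < k'" for s
    proof -
      have "M x $$ (s, s) = (\<Sum>f\<in>F. l f * m f s)" using s by (simp add: Mx m_def)
      also have "\<dots> = B s * (\<Sum>f\<in>F. l f * a f s)"
        by (simp add: m_eq sum_distrib_left mult_ac)
      also have "0 \<le> (\<Sum>f\<in>F. l f * a f s)"
        using tests[of "\<lambda>j. if j = s then 1 else 0"] s k by (simp add: coordinate_tests_def test_unit)
      then have "0 \<le> B s * (\<Sum>f\<in>F. l f * a f s)" using B0 by simp
      finally show ?thesis .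
    qed
    then have "M x \<in> psd_cone k'" using diagonal_psd_cone_iff[OF sym diag] x(1) by blast
    then have "\<phi> x \<in> convex hull F"
      using ext x(1) unfolding extended_formulation_def by auto
    then show "(\<Sum>f\<in>F. l f *\<^sub>R f) \<in> convex hull F" using x(2) p(3) by simp
  qed simp
qed

section \<open>Counting\<close>

text \<open>The polytope is the image of the simplex of convex weights on \<open>F\<close>; the
  equation for their sum takes two inequalities, hence the size \<open>N + 2\<close>. This makes the
  minima in \<open>sxc\<close> and \<open>xc\<close> attained.\<close>

lemma ex_linear_extension:
  fixes F :: "(real ^ 'd) set"
  assumes F: "finite F" "F \<noteq> {}"
  shows "\<exists>l. has_linear_extension l (convex hull F)"
proof -
  define N where "N = card F"
  have N: "1 \<le> N" using F by (simp add: N_def Suc_le_eq card_gt_0_iff)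
  obtain h where h: "bij_betw h {..<N} F"
    using ex_bij_betw_nat_finite[OF F(1)] by (auto simp: N_def atLeast0LessThan)
  define \<phi> where "\<phi> x = (\<Sum>i<N. vec_index x i *\<^sub>R h i)" for x
  define c where "c x s = (if s < N then vec_index x s else if s = N then (\<Sum>i<N. vec_index x i) - 1
      else 1 - (\<Sum>i<N. vec_index x i))" for x :: "real Matrix.vec" and s
  define M where "M x = mat (N + 2) (N + 2) (\<lambda>(s, t). if s = t then c x s else 0)" for x
  have c_affine: "c ((1 - t) \<cdot>\<^sub>v x + t \<cdot>\<^sub>v y) s = (1 - t) * c x s + t * c y s"
    if "x \<in> carrier_vec N" "y \<in> carrier_vec N" for x y t s
    using that by (simp add: c_def sum.distrib sum_distrib_left[symmetric] algebra_simps sum_subtractf)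
  have sym: "M x \<in> symmetric_mats (N + 2)" for x
    by (auto simp: M_def symmetric_mats_def intro!: eq_matI)
  have diag: "diagonal_mat (M x)" for x by (simp add: M_def diagonal_mat_def)
  have psd: "M x \<in> psd_cone (N + 2) \<longleftrightarrow> (\<forall>i<N. 0 \<le> vec_index x i) \<and> (\<Sum>i<N. vec_index x i) = 1" for x
  proof -
    have "M x \<in> psd_cone (N + 2) \<longleftrightarrow> (\<forall>s<N + 2. 0 \<le> c x s)"
      unfolding diagonal_psd_cone_iff[OF sym diag] by (auto simp: M_def)
    also have "\<dots> \<longleftrightarrow> (\<forall>i<N. 0 \<le> vec_index x i) \<and> (\<Sum>i<N. vec_index x i) = 1"
    proof
      assume nonneg: "\<forall>s<N + 2. 0 \<le> c x s"
      then have "0 \<le> c x N" "0 \<le> c x (N + 1)" "\<forall>i<N. 0 \<le> c x i" by auto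
      then show "(\<forall>i<N. 0 \<le> vec_index x i) \<and> (\<Sum>i<N. vec_index x i) = 1"
        by (simp add: c_def)
    qed (simp add: c_def)
    finally show ?thesis .
  qed
  have "affine_point_map N \<phi>"
    by (auto simp: affine_point_map_def \<phi>_def sum.distrib[symmetric] scaleR_sum_right algebra_simps
        intro!: sum.cong)
  moreover have "affine_matrix_map N (N + 2) M"
    unfolding affine_matrix_map_def
    by (intro conjI ballI allI sym eq_matI) (auto simp: M_def c_affine)
  moreover have "convex hull F = \<phi> ` {x \<in> carrier_vec N. M x \<in> psd_cone (N + 2)}"
  proof -
    have F_eq: "sum g F = (\<Sum>i<N. g (h i))" for g :: "_ \<Rightarrow> 'x :: comm_monoid_add"
      using sum.reindex_bij_betw[OF h, of g] by simp
    have hF: "h i \<in> F" if "i < N" for i using h that by (auto simp: bij_betw_def)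
    show ?thesis
    proof (intro equalityI subsetI)
      fix x assume "x \<in> convex hull F"
      then obtain w where w: "\<forall>f\<in>F. 0 \<le> w f" "sum w F = 1" "(\<Sum>f\<in>F. w f *\<^sub>R f) = x"
        unfolding convex_hull_finite[OF F(1)] by blast
      define y where "y = Matrix.vec N (\<lambda>i. w (h i))"
      have "M y \<in> psd_cone (N + 2)" unfolding psd using w hF by (simp add: y_def F_eq)
      moreover have "x = \<phi> y" using w(3) by (simp add: \<phi>_def y_def F_eq)
      ultimately show "x \<in> \<phi> ` {x \<in> carrier_vec N. M x \<in> psd_cone (N + 2)}"
        by (auto simp: y_def)
    next
      fix x assume "x \<in> \<phi> ` {x \<in> carrier_vec N. M x \<in> psd_cone (N + 2)}"
      then obtain y where "M y \<in> psd_cone (N + 2)" and x: "x = \<phi> y" by blast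
      then have y: "\<forall>i<N. 0 \<le> vec_index y i" "(\<Sum>i<N. vec_index y i) = 1" unfolding psd by blast+
      have "(\<Sum>i<N. vec_index y i *\<^sub>R h i) \<in> convex hull F"
        using y hF by (intro convex_sum) (auto simp: hull_inc)
      then show "x \<in> convex hull F" by (simp add: x \<phi>_def)
    qed
  qed
  ultimately have "extended_formulation N (N + 2) \<phi> M (convex hull F)"
    using N by (simp add: extended_formulation_def)
  then show ?thesis using diag unfolding has_linear_extension_def by blast
qed

lemma sxc_attained:
  assumes "finite F" "convex hull F \<noteq> {}" "\<nexists>p. convex hull F = {p}"
  shows "has_LMI_extension (sxc (convex hull F)) (convex hull F)"
proof -
  have "\<exists>l. has_linear_extension l (convex hull F)" using assms by (intro ex_linear_extension) auto
  then have "\<exists>l. has_LMI_extension l (convex hull F)"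
    unfolding has_linear_extension_def has_LMI_extension_def by blast
  moreover have "sxc (convex hull F) = (LEAST k. has_LMI_extension k (convex hull F))"
    using assms by (simp add: sxc_def)
  ultimately show ?thesis using LeastI_ex[of "\<lambda>k. has_LMI_extension k (convex hull F)"] by simp
qed

lemma xc_attained:
  assumes "finite F" "convex hull F \<noteq> {}" "\<nexists>p. convex hull F = {p}"
  shows "has_linear_extension (xc (convex hull F)) (convex hull F)"
proof -
  have "\<exists>l. has_linear_extension l (convex hull F)" using assms by (intro ex_linear_extension) auto
  moreover have "xc (convex hull F) = (LEAST l. has_linear_extension l (convex hull F))"
    using assms by (simp add: xc_def)
  ultimately show ?thesis using LeastI_ex[of "\<lambda>l. has_linear_extension l (convex hull F)"] by simp
qed

text \<open>Here \<open>sxc\<close> and \<open>xc\<close> are 0 by convention, so their value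
  supplies no formulation; the zero lift is used directly.\<close>

lemma trivial_normalized_lift:
  fixes F :: "(real ^ 'd) set" and T :: "('j \<Rightarrow> real) set"
  assumes J: "finite J" and F: "F \<subseteq> zero_one_points"
    and triv: "convex hull F = {} \<or> (\<exists>p. convex hull F = {p})" and T: "(\<lambda>_. 0) \<in> T"
  shows "normalized_lift J T \<kappa> F (\<lambda>_ _. 0)"
proof
  fix t assume "t \<in> T"
  show "\<exists>s\<in>T. (\<forall>f\<in>F. (\<Sum>j\<in>J. s j * 0) = (\<Sum>j\<in>J. t j * 0)) \<and>
      (\<Sum>j\<in>J. \<bar>s j\<bar>) \<le> \<kappa> * (\<Sum>f\<in>F. \<Sum>j\<in>J. s j * 0)"
    using T by (intro bexI[of _ "\<lambda>_. 0"]) auto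
next
  fix l :: "real ^ 'd \<Rightarrow> real" assume l: "sum l F = 1"
  then have "F \<noteq> {}" by auto
  then obtain p where p: "convex hull F = {p}" using triv by auto
  then have "F = {p}" using hull_subset[of F convex] \<open>F \<noteq> {}\<close> by auto
  then show "(\<Sum>f\<in>F. l f *\<^sub>R f) \<in> convex hull F" using l by simp
qed (use J F in auto)

text \<open>Padding brings all sizes up to \<open>k\<close> to a common index set, so that one count
  covers them.\<close>

lemma sxc_le_subset:
  "{P \<in> subpolytopes (zero_one_points :: (real ^ 'd) set). sxc P \<le> k}
     \<subseteq> normalized_hulls ({..<k} \<times> {..<k}) quadratic_tests (real k)"
proof
  fix P assume P: "P \<in> {P \<in> subpolytopes (zero_one_points :: (real ^ 'd) set). sxc P \<le> k}"
  then obtain F where F: "F \<subseteq> zero_one_points" "P = convex hull F"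
    by (auto simp: subpolytopes_def)
  then have finF: "finite F" using finite_zero_one_points finite_subset by blast
  have "\<exists>a. normalized_lift ({..<k} \<times> {..<k}) quadratic_tests (real k) F a"
  proof (cases "convex hull F = {} \<or> (\<exists>p. convex hull F = {p})")
    case True
    have "(\<lambda>_. 0) \<in> quadratic_tests"
      unfolding quadratic_tests_def by (rule range_eqI[of _ _ "\<lambda>_. 0"]) auto
    then show ?thesis by (intro exI) (rule trivial_normalized_lift[OF _ F(1) True], simp)
  next
    case False
    then have "has_LMI_extension (sxc P) (convex hull F)"
      using sxc_attained[OF finF] F(2) by simp
    moreover have "sxc P \<le> k" using P by simp
    ultimately show ?thesis using F(1) by (rule LMI_normalized_lift)
  qed
  then show "P \<in> normalized_hulls ({..<k} \<times> {..<k}) quadratic_tests (real k)"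
    using F(2) unfolding normalized_hulls_def by blast
qed

lemma xc_le_subset:
  "{P \<in> subpolytopes (zero_one_points :: (real ^ 'd) set). xc P \<le> l}
     \<subseteq> normalized_hulls {..<l} coordinate_tests 1"
proof
  fix P assume P: "P \<in> {P \<in> subpolytopes (zero_one_points :: (real ^ 'd) set). xc P \<le> l}"
  then obtain F where F: "F \<subseteq> zero_one_points" "P = convex hull F"
    by (auto simp: subpolytopes_def)
  then have finF: "finite F" using finite_zero_one_points finite_subset by blast
  have "\<exists>a. normalized_lift {..<l} coordinate_tests 1 F a"
  proof (cases "convex hull F = {} \<or> (\<exists>p. convex hull F = {p})")
    case True
    have "(\<lambda>_. 0) \<in> coordinate_tests" by (simp add: coordinate_tests_def)
    then show ?thesis by (intro exI) (rule trivial_normalized_lift[OF _ F(1) True], simp)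
  next
    case False
    then have "has_linear_extension (xc P) (convex hull F)"
      using xc_attained[OF finF] F(2) by simp
    moreover have "xc P \<le> l" using P by simp
    ultimately show ?thesis using F(1) by (rule linear_normalized_lift)
  qed
  then show "P \<in> normalized_hulls {..<l} coordinate_tests 1"
    using F(2) unfolding normalized_hulls_def by blast
qed

section \<open>Numerical bounds on the number of hulls\<close>

lemma normalized_hulls_subset:
  "normalized_hulls J T \<kappa> \<subseteq> subpolytopes (zero_one_points :: (real ^ 'd) set)"
  using normalized_lift.points unfolding normalized_hulls_def subpolytopes_def by blast

text \<open>Without matrix coordinates the bound from rounding is too weak for small
  \<open>d\<close>. Applying \<open>point_determined\<close> to a difference of two indicator
  functions shows instead that \<open>F\<close> has at most one point.\<close>

lemma card_normalized_hulls_empty: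
  "card (normalized_hulls {} T \<kappa> :: (real ^ 'd) set set) \<le> 2 ^ CARD('d) + 1"
proof -
  have "normalized_hulls {} T \<kappa> \<subseteq> insert {} ((\<lambda>p. {p}) ` (zero_one_points :: (real ^ 'd) set))"
  proof
    fix P :: "(real ^ 'd) set" assume "P \<in> normalized_hulls {} T \<kappa>"
    then obtain F a where P: "P = convex hull F" and lift: "normalized_lift {} T \<kappa> F a"
      unfolding normalized_hulls_def by blast
    interpret normalized_lift "{}" T \<kappa> F a by fact
    have "p = q" if pq: "p \<in> F" "q \<in> F" for p q
    proof (rule ccontr)
      assume ne: "p \<noteq> q"
      define z :: "real ^ 'd \<Rightarrow> real" where "z f = (if f = p then 1 else 0) - (if f = q then 1 else 0)" for f
      have "sum z F = 0" using pq finite_F by (simp add: z_def sum_subtractf)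
      then have "(\<Sum>f\<in>F. z f *\<^sub>R f) = 0" by (rule point_determined) simp
      moreover have "(\<Sum>f\<in>F. z f *\<^sub>R f) = (\<Sum>f\<in>F. (if f = p then p else 0) - (if f = q then q else 0))"
        by (intro sum.cong) (auto simp: z_def)
      ultimately show False using pq finite_F ne by (simp add: sum_subtractf)
    qed
    then have "F = {} \<or> (\<exists>p\<in>F. F = {p})" by blast
    then show "P \<in> insert {} ((\<lambda>p. {p}) ` zero_one_points)" using P points by auto
  qed
  then have "card (normalized_hulls {} T \<kappa> :: (real ^ 'd) set set)
      \<le> card (insert {} ((\<lambda>p. {p}) ` (zero_one_points :: (real ^ 'd) set)))"
    by (intro card_mono) (auto simp: finite_zero_one_points)
  also have "\<dots> \<le> card ((\<lambda>p. {p}) ` (zero_one_points :: (real ^ 'd) set)) + 1"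
    by (metis Suc_eq_plus1 card_insert_le_m1 card_insert_if finite_imageI finite_zero_one_points le_SucI order_refl)
  also have "\<dots> = 2 ^ CARD('d) + 1"
    by (simp add: card_image card_zero_one_points)
  finally show ?thesis .
qed

text \<open>The hypothesis on \<open>card J\<close> yields both the precision required for rounding
  and the estimate of the exponent. It is used with \<open>k * k\<close> coordinates for matrices
  and \<open>l\<close> for inequalities, which explains the two different thresholds.\<close>

lemma card_normalized_hulls_le:
  fixes J :: "'j set" and \<kappa> :: real
  assumes J: "finite J" and kappa: "0 \<le> \<kappa>" "\<kappa> \<le> max 1 (card J)"
    and d: "CARD('d) = d" "3 \<le> d" and m: "81 * d\<^sup>2 * (card J)\<^sup>2 \<le> 2 ^ d"
  shows "card (normalized_hulls J T \<kappa> :: (real ^ 'd) set set) \<le> 2 ^ 2 ^ (d - 1)"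
proof (cases "J = {}")
  case True
  have "n + 4 \<le> (2 :: nat) ^ (n + 2)" for n by (induction n) auto
  moreover obtain n where "d = n + 3" using d(2) by (metis add.commute le_Suc_ex)
  ultimately have "d + 1 \<le> 2 ^ (d - 1)" by (simp add: add.commute[of _ 4])
  then have "(2 :: nat) ^ (d + 1) \<le> 2 ^ 2 ^ (d - 1)" by (intro power_increasing) auto
  moreover have "card (normalized_hulls J T \<kappa> :: (real ^ 'd) set set) \<le> 2 ^ d + 1"
    using card_normalized_hulls_empty[where 'd = 'd, of T \<kappa>] d by (simp add: True)
  moreover have "(2 :: nat) ^ d + 1 \<le> 2 ^ (d + 1)" by simp
  ultimately show ?thesis by (meson order_trans)
next
  case False
  define m where "m = card J"
  have m1: "1 \<le> m" using False J by (simp add: m_def Suc_le_eq card_gt_0_iff)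
  have le: "81 * d\<^sup>2 * m\<^sup>2 \<le> 2 ^ d" using m by (simp add: m_def)
  \<comment> \<open>As \<open>\<kappa>\<close> is at most \<open>m\<close>, the left side is at most
    \<open>6 * d * m\<^sup>2 / 2 ^ d\<close>.\<close>
  have small: "2 * CARD('d) * (2 * ((card J + 1) / 4 ^ CARD('d)) + \<kappa> * ((card J + 1) / 4 ^ CARD('d)) * 2 ^ CARD('d)) < 1"
  proof -
    define x where "x = real m"
    define p where "p = (2 :: real) ^ d"
    have x: "1 \<le> x" "\<kappa> \<le> x" using m1 kappa by (simp_all add: x_def m_def)
    have p: "4 \<le> p" using d power_increasing[of 2 d "2 :: real"] by (simp add: p_def)
    have four: "(4 :: real) ^ d = p * p" by (simp add: p_def power_mult_distrib[symmetric])
    have "real (81 * d\<^sup>2 * m\<^sup>2) \<le> real (2 ^ d)" using le by (rule of_nat_mono)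
    then have lex: "81 * (real d)\<^sup>2 * x\<^sup>2 \<le> p" by (simp add: x_def p_def)
    have xx: "x \<le> x\<^sup>2" using x self_le_power[of x 2] by simp
    have "\<kappa> * (x + 1) \<le> x * (2 * x)" using x kappa by (intro mult_mono) auto
    then have "\<kappa> * (x + 1) * p \<le> 2 * x\<^sup>2 * p" using p by (intro mult_right_mono) (auto simp: power2_eq_square)
    moreover have "2 * (x + 1) \<le> x\<^sup>2 * p"
    proof -
      have "2 * (x + 1) \<le> 4 * x" using x by simp
      also have "\<dots> \<le> p * x\<^sup>2" using p x xx by (intro mult_mono) auto
      finally show ?thesis by (simp add: mult.commute)
    qed
    ultimately have "2 * (x + 1) + \<kappa> * (x + 1) * p \<le> 3 * x\<^sup>2 * p" by simp
    then have "2 * d * (2 * (x + 1) + \<kappa> * (x + 1) * p) \<le> 2 * d * (3 * x\<^sup>2 * p)"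
      by (intro mult_left_mono) auto
    also have "\<dots> = 6 * d * x\<^sup>2 * p" by simp
    also have "\<dots> < p * p"
    proof (intro mult_strict_right_mono)
      have "real d * 1 \<le> real d * real d" using d by (intro mult_left_mono) auto
      then have "6 * d * x\<^sup>2 \<le> 6 * (real d)\<^sup>2 * x\<^sup>2"
        by (intro mult_right_mono) (auto simp: power2_eq_square)
      also have "\<dots> < 81 * (real d)\<^sup>2 * x\<^sup>2"
        using d x by simp
      finally show "6 * d * x\<^sup>2 < p" using lex by linarith
    qed (use p in simp)
    finally have "2 * d * (2 * (x + 1) + \<kappa> * (x + 1) * p) / (p * p) < 1"
      using p by (simp add: divide_less_eq_1)
    moreover have "c * (2 * (a / q) + \<kappa> * (a / q) * b) = c * (2 * a + \<kappa> * a * b) / q" for a b c q :: real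
      by (simp add: add_divide_distrib distrib_left)
    then have "2 * d * (2 * ((m + 1) / 4 ^ d) + \<kappa> * ((m + 1) / 4 ^ d) * 2 ^ d) =
        2 * d * (2 * (x + 1) + \<kappa> * (x + 1) * p) / (p * p)"
      unfolding four p_def[symmetric] of_nat_add of_nat_1 x_def[symmetric] .
    ultimately show ?thesis by (simp add: m_def d)
  qed
  have "card (normalized_hulls J T \<kappa> :: (real ^ 'd) set set)
      \<le> (2 * 8 ^ d + 1) ^ ((m + 1) * (m + 1 + d))"
    using card_normalized_hulls[OF J kappa(1) small, where T = T] by (simp add: m_def d)
  also have "\<dots> \<le> (2 ^ (3 * d + 2)) ^ ((m + 1) * (m + 1 + d))"
  proof (rule power_mono)
    have "(8 :: nat) ^ d = 2 ^ (3 * d)" by (simp add: power_mult)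
    then show "2 * 8 ^ d + 1 \<le> (2 :: nat) ^ (3 * d + 2)" by simp
  qed simp
  also have "\<dots> = 2 ^ ((3 * d + 2) * ((m + 1) * (m + 1 + d)))" by (simp only: power_mult)
  also have "\<dots> \<le> 2 ^ 2 ^ (d - 1)"
  proof (rule power_increasing)
    \<comment> \<open>Twice the exponent is at most
      \<open>4 * (3 * d + 2) * (d + 2) * m\<^sup>2\<close>, and for \<open>d\<close> at least 3 the
      polynomial in \<open>d\<close> is at most \<open>81 * d\<^sup>2\<close>.\<close>
    have "m + 1 \<le> 2 * m" using m1 by simp
    moreover have "m + 1 + d \<le> m * (d + 2)"
    proof -
      have "d \<le> m * d" using m1 by (cases m) auto
      then show ?thesis unfolding distrib_left using m1 by linarith
    qed
    ultimately have "(m + 1) * (m + 1 + d) \<le> (2 * m) * (m * (d + 2))" by (rule mult_le_mono)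
    then have "2 * ((3 * d + 2) * ((m + 1) * (m + 1 + d))) \<le> 2 * ((3 * d + 2) * ((2 * m) * (m * (d + 2))))"
      by (intro mult_le_mono2)
    also have "\<dots> = (4 * (3 * d + 2) * (d + 2)) * m\<^sup>2"
      by (simp add: power2_eq_square algebra_simps)
    also have "\<dots> \<le> (81 * d\<^sup>2) * m\<^sup>2"
    proof (rule mult_le_mono1)
      have "3 * d \<le> d * d" using d by (intro mult_le_mono1)
      moreover have "3 * 3 \<le> d * d" using d by (intro mult_le_mono)
      moreover have "4 * (3 * d + 2) * (d + 2) = 12 * (d * d) + 32 * d + 16"
        by (simp add: algebra_simps)
      ultimately show "4 * (3 * d + 2) * (d + 2) \<le> 81 * d\<^sup>2"
        unfolding power2_eq_square by linarith
    qed
    also have "\<dots> \<le> 2 ^ d" by (rule le)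
    also have "2 ^ d = 2 * (2 :: nat) ^ (d - 1)" using d by (simp flip: power_Suc)
    finally show "(3 * d + 2) * ((m + 1) * (m + 1 + d)) \<le> 2 ^ (d - 1)" by simp
  qed simp
  finally show ?thesis .
qed

section \<open>The probability estimate\<close>

lemma card_subpolytopes_zero_one:
  "card (subpolytopes (zero_one_points :: (real ^ 'd) set)) = 2 ^ 2 ^ CARD('d)"
  unfolding subpolytopes_conv_image
  by (simp add: card_image inj_on_convex_hull_zero_one card_Pow finite_zero_one_points card_zero_one_points)

text \<open>The bound on \<open>card H\<close> is the square root of the number
  \<open>2 ^ 2 ^ d\<close> of all 0/1-polytopes, so the quotient is its reciprocal.\<close>

lemma prob_subpolytopes_le:
  fixes A :: "(real ^ 'd) set set"
  assumes d: "CARD('d) = d" "3 \<le> d"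
    and A: "subpolytopes zero_one_points \<inter> A \<subseteq> H" and H: "H \<subseteq> subpolytopes zero_one_points"
      "card H \<le> 2 ^ 2 ^ (d - 1)"
  shows "measure_pmf.prob (pmf_of_set (subpolytopes zero_one_points)) A \<le> 2 powr - (2 ^ (d - 1))"
proof -
  let ?S = "subpolytopes (zero_one_points :: (real ^ 'd) set)"
  have fin: "finite ?S" by (intro finite_subpolytopes finite_zero_one_points)
  have "card (?S \<inter> A) \<le> card H" using A H fin finite_subset by (intro card_mono) blast+
  then have le: "card (?S \<inter> A) \<le> 2 ^ 2 ^ (d - 1)" using H by simp
  have exp: "2 ^ d = 2 ^ (d - 1) + (2 :: nat) ^ (d - 1)"
    using d by (cases d) auto
  have "measure_pmf.prob (pmf_of_set ?S) A = card (?S \<inter> A) / card ?S"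
    using subpolytopes_nonempty fin by (rule measure_pmf_of_set)
  also have "\<dots> \<le> 2 ^ 2 ^ (d - 1) / 2 ^ 2 ^ d"
    using of_nat_mono[OF le, where 'a = real]
    by (simp add: card_subpolytopes_zero_one d divide_right_mono)
  also have "\<dots> = 1 / 2 ^ 2 ^ (d - 1)"
    unfolding exp power_add by simp
  also have "\<dots> = 2 powr - (2 ^ (d - 1))"
    using powr_realpow[of "2 :: real" "2 ^ (d - 1)"] by (simp add: powr_minus_divide)
  finally show ?thesis .
qed

theorem corollary8:
  fixes d :: nat
    and \<P> :: "(real ^ 'd) set pmf"
  assumes "CARD('d) = d"
    and "3 \<le> d"
    and "\<P> = pmf_of_set (subpolytopes zero_one_points)"
  shows "measure_pmf.prob \<P> {P. real (sxc P) \<le> 2 powr (real d / 4) / (3 * sqrt (real d))}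
           \<le> 2 powr - (2 ^ (d - 1)) \<and>
         measure_pmf.prob \<P> {P. real (xc P) \<le> 2 powr (real d / 2) / (9 * real d)}
           \<le> 2 powr - (2 ^ (d - 1))"
proof
  define x where "x = 2 powr (real d / 4) / (3 * sqrt (real d))"
  \<comment> \<open>Complexities are integers, so the threshold can be replaced by its
    floor.\<close>
  define k where "k = nat \<lfloor>x\<rfloor>"
  have x0: "0 \<le> x" by (simp add: x_def)
  have kx: "real k \<le> x" and k_iff: "real n \<le> x \<longleftrightarrow> n \<le> k" for n
    using x0 by (simp_all add: k_def le_nat_floor le_nat_iff le_floor_iff)
  \<comment> \<open>The fourth power arises because a matrix of size \<open>k\<close> has
    \<open>k * k\<close> coordinates and their number is squared in the count; \<open>x\<close> is
    calibrated to give exactly \<open>2 ^ d\<close>.\<close>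
  have "81 * (real d)\<^sup>2 * real k ^ 4 \<le> 81 * (real d)\<^sup>2 * x ^ 4"
    using kx by (intro mult_left_mono power_mono) auto
  also have "\<dots> = 2 ^ d"
  proof -
    have "(2 powr (real d / 4)) ^ 4 = 2 ^ d"
      by (simp add: powr_realpow[symmetric] powr_powr)
    moreover have "sqrt (real d) ^ 4 = (real d)\<^sup>2"
      using power_mult[of "sqrt (real d)" 2 2] by simp
    ultimately show ?thesis using assms(2) by (simp add: x_def power_divide power_mult_distrib)
  qed
  finally have "real (81 * d\<^sup>2 * (k * k)\<^sup>2) \<le> real (2 ^ d)"
    by (simp add: power2_eq_square power4_eq_xxxx mult.assoc)
  then have "81 * d\<^sup>2 * (card ({..<k} \<times> {..<k}))\<^sup>2 \<le> 2 ^ d"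
    by (simp only: of_nat_le_iff card_cartesian_product card_lessThan)
  moreover have "real k \<le> max 1 (card ({..<k} \<times> {..<k}))"
    by (cases k) (auto simp: card_cartesian_product)
  ultimately have "card (normalized_hulls ({..<k} \<times> {..<k}) quadratic_tests (real k) :: (real ^ 'd) set set) \<le> 2 ^ 2 ^ (d - 1)"
    by (intro card_normalized_hulls_le[OF _ _ _ assms(1,2)]) auto
  then show "measure_pmf.prob \<P> {P. real (sxc P) \<le> x} \<le> 2 powr - (2 ^ (d - 1))"
    unfolding assms(3) k_iff
    using sxc_le_subset by (intro prob_subpolytopes_le[OF assms(1,2) _ normalized_hulls_subset]) auto
  define y where "y = 2 powr (real d / 2) / (9 * real d)"
  define l where "l = nat \<lfloor>y\<rfloor>"
  have y0: "0 \<le> y" by (simp add: y_def)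
  have ly: "real l \<le> y" and l_iff: "real n \<le> y \<longleftrightarrow> n \<le> l" for n
    using y0 by (simp_all add: l_def le_nat_floor le_nat_iff le_floor_iff)
  \<comment> \<open>There are only \<open>l\<close> coordinates here, so the square takes the place
    of the fourth power.\<close>
  have "81 * (real d)\<^sup>2 * (real l)\<^sup>2 \<le> 81 * (real d)\<^sup>2 * y\<^sup>2"
    using ly by (intro mult_left_mono power_mono) auto
  also have "\<dots> = 2 ^ d"
  proof -
    have "(2 powr (real d / 2))\<^sup>2 = 2 ^ d"
      by (simp add: powr_realpow[symmetric] powr_powr)
    then show ?thesis using assms(2) by (simp add: y_def power_divide power_mult_distrib)
  qed
  finally have "real (81 * d\<^sup>2 * l\<^sup>2) \<le> real (2 ^ d)" by simp
  then have "81 * d\<^sup>2 * (card {..<l})\<^sup>2 \<le> 2 ^ d" by (simp only: of_nat_le_iff card_lessThan)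
  then have "card (normalized_hulls {..<l} coordinate_tests 1 :: (real ^ 'd) set set) \<le> 2 ^ 2 ^ (d - 1)"
    by (intro card_normalized_hulls_le[OF _ _ _ assms(1,2)]) auto
  then show "measure_pmf.prob \<P> {P. real (xc P) \<le> y} \<le> 2 powr - (2 ^ (d - 1))"
    unfolding assms(3) l_iff
    using xc_le_subset by (intro prob_subpolytopes_le[OF assms(1,2) _ normalized_hulls_subset]) auto
qed

end
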